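(* Let $\mathsf{T}$ be a rooted plane tree with $n\geq 2$ nodes and root $\mathfrak{r}$. Then \[\max_{\delta\in\mathcal{O}(\mathsf{T})}|\mathrm{Orb}_{\mathsf{Pop}}(\delta)|=\max_{C\in\mathcal{M}_{\mathsf{T}}}\ \min_{v\in C\setminus\{\mathfrak{r}\}}\bigl(|\Delta_\mathsf{T}(v)|+2\,\mathrm{depth}_\mathsf{T}(v)-1\bigr).\]
   Context: A rooted plane tree $\mathsf{T}$ is a finite tree with a distinguished root $\mathfrak{r}$, regarded as a poset $\leq_\mathsf{T}$ in which $v'\leq_\mathsf{T} v$ iff $v$ lies on the path from $v'$ to $\mathfrak{r}$ (so $\mathfrak{r}$ is the maximum and every non-root node is covered by exactly one node, its parent). For $v\in\mathsf{T}$, $\Delta_\mathsf{T}(v)=\{v'\in\mathsf{T}:v'\leq_\mathsf{T} v\}$ and $\nabla_\mathsf{T}(v)=\{v'\in\mathsf{T}:v\leq_\mathsf{T} v'\}$; $\mathrm{depth}_\mathsf{T}(v)=|\nabla_\mathsf{T}(v)|-1$. $\mathcal{M}_\mathsf{T}$ is the set of maximal chains of the poset $\mathsf{T}$ (i.e., paths from a leaf to the root). An ornament of $\mathsf{T}$ is a nonempty set of nodes inducing a connected subgraph. An ornamentation of $\mathsf{T}$ is a map $\delta$ from $\mathsf{T}$ to ornaments such that (1) for every $v$, the unique maximal element of $\delta(v)$ is $v$; (2) for all $v,v'$, the sets $\delta(v),\delta(v')$ are either nested (one contains the other) or disjoint. $\mathcal{O}(\mathsf{T})$ is the set of ornamentations,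 partially ordered by $\delta\leq\delta'$ iff $\delta(v)\subseteq\delta'(v)$ for all $v$; this is a lattice with meet $(\delta\wedge\delta')(v)=\delta(v)\cap\delta'(v)$. The pop-stack operator $\mathsf{Pop}\colon\mathcal{O}(\mathsf{T})\to\mathcal{O}(\mathsf{T})$ is $\mathsf{Pop}(\delta)=\bigwedge(\{\delta\}\cup\{\delta':\delta'\lessdot\delta\})$, where $\lessdot$ is the cover relation. $\mathrm{Orb}_{\mathsf{Pop}}(\delta)=\{\delta,\mathsf{Pop}(\delta),\mathsf{Pop}^2(\delta),\dots\}$ is the forward orbit. *)

theory Defs
  imports Main
begin

text \<open>A rooted tree on the finite node set V with root r, given by a parent map:
  every node other than the root has its parent in V, and iterating the parent map
  from any node reaches the root.  (The plane embedding is irrelevant here.)\<close>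
definition rooted_tree :: "'a set \<Rightarrow> ('a \<Rightarrow> 'a) \<Rightarrow> 'a \<Rightarrow> bool" where
  "rooted_tree V par r \<longleftrightarrow> finite V \<and> r \<in> V \<and>
     (\<forall>v\<in>V. v \<noteq> r \<longrightarrow> par v \<in> V) \<and>
     (\<forall>v\<in>V. \<exists>k. (par ^^ k) v = r)"

definition tle :: "'a set \<Rightarrow> ('a \<Rightarrow> 'a) \<Rightarrow> 'a \<Rightarrow> 'a \<Rightarrow> 'a \<Rightarrow> bool" where
  "tle V par r u v \<longleftrightarrow> u \<in> V \<and> v \<in> V \<and>
     (\<exists>k. (par ^^ k) u = v \<and> (\<forall>j<k. (par ^^ j) u \<noteq> r))"

definition tlt :: "'a set \<Rightarrow> ('a \<Rightarrow> 'a) \<Rightarrow> 'a \<Rightarrow> 'a \<Rightarrow> 'a \<Rightarrow> bool" where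
  "tlt V par r u v \<longleftrightarrow> tle V par r u v \<and> u \<noteq> v"

definition down :: "'a set \<Rightarrow> ('a \<Rightarrow> 'a) \<Rightarrow> 'a \<Rightarrow> 'a \<Rightarrow> 'a set" where
  "down V par r v = {u \<in> V. tle V par r u v}"

definition up :: "'a set \<Rightarrow> ('a \<Rightarrow> 'a) \<Rightarrow> 'a \<Rightarrow> 'a \<Rightarrow> 'a set" where
  "up V par r v = {u \<in> V. tle V par r v u}"

definition depth :: "'a set \<Rightarrow> ('a \<Rightarrow> 'a) \<Rightarrow> 'a \<Rightarrow> 'a \<Rightarrow> nat" where
  "depth V par r v = card (up V par r v) - 1"

definition is_chain :: "'a set \<Rightarrow> ('a \<Rightarrow> 'a) \<Rightarrow> 'a \<Rightarrow> 'a set \<Rightarrow> bool" where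
  "is_chain V par r C \<longleftrightarrow> C \<subseteq> V \<and>
     (\<forall>x\<in>C. \<forall>y\<in>C. tle V par r x y \<or> tle V par r y x)"

definition max_chains :: "'a set \<Rightarrow> ('a \<Rightarrow> 'a) \<Rightarrow> 'a \<Rightarrow> 'a set set" where
  "max_chains V par r = {C. is_chain V par r C \<and>
     (\<forall>D. is_chain V par r D \<and> C \<subseteq> D \<longrightarrow> D = C)}"

definition tadj :: "'a set \<Rightarrow> ('a \<Rightarrow> 'a) \<Rightarrow> 'a \<Rightarrow> 'a \<Rightarrow> 'a \<Rightarrow> bool" where
  "tadj V par r x y \<longleftrightarrow> (x \<in> V \<and> x \<noteq> r \<and> y = par x) \<or> (y \<in> V \<and> y \<noteq> r \<and> x = par y)"

definition ornament :: "'a set \<Rightarrow> ('a \<Rightarrow> 'a) \<Rightarrow> 'a \<Rightarrow> 'a set \<Rightarrow> bool" where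
  "ornament V par r S \<longleftrightarrow> S \<noteq> {} \<and> S \<subseteq> V \<and>
     (\<forall>x\<in>S. \<forall>y\<in>S. (\<lambda>a b. a \<in> S \<and> b \<in> S \<and> tadj V par r a b)\<^sup>*\<^sup>* x y)"

definition ornamentation :: "'a set \<Rightarrow> ('a \<Rightarrow> 'a) \<Rightarrow> 'a \<Rightarrow> ('a \<Rightarrow> 'a set) \<Rightarrow> bool" where
  "ornamentation V par r \<delta> \<longleftrightarrow>
     (\<forall>v. v \<notin> V \<longrightarrow> \<delta> v = {}) \<and>
     (\<forall>v\<in>V. ornament V par r (\<delta> v) \<and> v \<in> \<delta> v \<and>
        (\<forall>u\<in>\<delta> v. \<not> tlt V par r v u) \<and>
        (\<forall>u\<in>\<delta> v. (\<forall>w\<in>\<delta> v. \<not> tlt V par r u w) \<longrightarrow> u = v)) \<and>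
     (\<forall>v\<in>V. \<forall>v'\<in>V. \<delta> v \<subseteq> \<delta> v' \<or> \<delta> v' \<subseteq> \<delta> v \<or> \<delta> v \<inter> \<delta> v' = {})"

definition Orn :: "'a set \<Rightarrow> ('a \<Rightarrow> 'a) \<Rightarrow> 'a \<Rightarrow> ('a \<Rightarrow> 'a set) set" where
  "Orn V par r = {\<delta>. ornamentation V par r \<delta>}"

definition ole :: "'a set \<Rightarrow> ('a \<Rightarrow> 'a set) \<Rightarrow> ('a \<Rightarrow> 'a set) \<Rightarrow> bool" where
  "ole V \<delta> \<delta>' \<longleftrightarrow> (\<forall>v\<in>V. \<delta> v \<subseteq> \<delta>' v)"

definition ocover :: "'a set \<Rightarrow> ('a \<Rightarrow> 'a) \<Rightarrow> 'a \<Rightarrow> ('a \<Rightarrow> 'a set) \<Rightarrow> ('a \<Rightarrow> 'a set) \<Rightarrow> bool" where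
  "ocover V par r \<delta>' \<delta> \<longleftrightarrow> \<delta>' \<in> Orn V par r \<and> \<delta> \<in> Orn V par r \<and>
     ole V \<delta>' \<delta> \<and> \<delta>' \<noteq> \<delta> \<and>
     (\<forall>\<gamma>\<in>Orn V par r. ole V \<delta>' \<gamma> \<and> ole V \<gamma> \<delta> \<longrightarrow> \<gamma> = \<delta>' \<or> \<gamma> = \<delta>)"

text \<open>Pop-stack operator: meet (pointwise intersection) of \<delta> and all elements it covers.\<close>
definition Pop :: "'a set \<Rightarrow> ('a \<Rightarrow> 'a) \<Rightarrow> 'a \<Rightarrow> ('a \<Rightarrow> 'a set) \<Rightarrow> ('a \<Rightarrow> 'a set)" where
  "Pop V par r \<delta> = (\<lambda>v. \<delta> v \<inter> (\<Inter>\<delta>'\<in>{\<delta>'. ocover V par r \<delta>' \<delta>}. \<delta>' v))"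

definition orbit :: "'a set \<Rightarrow> ('a \<Rightarrow> 'a) \<Rightarrow> 'a \<Rightarrow> ('a \<Rightarrow> 'a set) \<Rightarrow> ('a \<Rightarrow> 'a set) set" where
  "orbit V par r \<delta> = {(Pop V par r ^^ k) \<delta> | k. True}"

end

theory Submission
  imports Defs
begin

text \<open>
  One application of \<open>Pop\<close> removes from each ornament \<open>\<delta> v\<close> all those maximal inner ornaments \<open>\<delta> u\<close>
  that contain everything of \<open>\<delta> v\<close> below \<open>u\<close>.

  Upper bound: for fixed \<open>w\<close>, the part of \<open>\<delta> x\<close> below \<open>w\<close> shrinks at every step, unless it coincides
  with the part below \<open>w\<close> of an ornament strictly between. Hence \<open>w\<close> leaves the ornament of its
  \<open>i\<close>-th ancestor after at most \<open>|\<Delta>(w)| + i - 1\<close> steps. On the other hand, once all children of \<open>w\<close>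
  have left, only \<open>w\<close> itself remains to be removed; so if all children leave their \<open>i\<close>-th ancestors
  by time \<open>s + i - 1\<close>, then \<open>w\<close> leaves its \<open>i\<close>-th ancestor by time \<open>(s + 2) + i - 1\<close>.
  Unfolding the minimum of these two bounds along the tree gives the maximum over the leaf-to-root chains.

  Lower bound: climb from the leaf of a chain to the root. At each node \<open>v\<close> either all nodes below \<open>v\<close> are
  already used, or one further node below \<open>v\<close> is added and \<open>v\<close> gets the ornament collected so far,
  which protects the collected nodes in the ornaments above. The ornament of the root then loses a single
  node at each step, and the number of its nodes is large enough.
\<close>

subsection \<open>The tree order\<close>

locale rtree =
  fixes V :: "'a set" and par :: "'a \<Rightarrow> 'a" and r :: 'a
  assumes rooted: "rooted_tree V par r"
begin

abbreviation le (infix "\<sqsubseteq>" 50) where "u \<sqsubseteq> v \<equiv> tle V par r u v"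
abbreviation lt (infix "\<sqsubset>" 50) where "u \<sqsubset> v \<equiv> tlt V par r u v"
abbreviation dn where "dn \<equiv> down V par r"
abbreviation dep where "dep \<equiv> depth V par r"
abbreviation orn where "orn \<equiv> ornamentation V par r"
abbreviation pop where "pop \<equiv> Pop V par r"

lemma finite_V: "finite V" and root_in_V: "r \<in> V"
  and par_in_V: "v \<in> V \<Longrightarrow> v \<noteq> r \<Longrightarrow> par v \<in> V"
  and reaches_root: "v \<in> V \<Longrightarrow> \<exists>k. (par ^^ k) v = r"
  using rooted unfolding rooted_tree_def by auto

lemma le_V: "u \<sqsubseteq> v \<Longrightarrow> u \<in> V" "u \<sqsubseteq> v \<Longrightarrow> v \<in> V"
  by (auto simp: tle_def)

lemma le_refl: "v \<in> V \<Longrightarrow> v \<sqsubseteq> v"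
  unfolding tle_def by (auto intro: exI[of _ 0])

lemma le_trans: assumes "u \<sqsubseteq> v" "v \<sqsubseteq> w" shows "u \<sqsubseteq> w"
proof -
  obtain k where k: "(par ^^ k) u = v" "\<forall>j<k. (par ^^ j) u \<noteq> r" using assms by (auto simp: tle_def)
  obtain l where l: "(par ^^ l) v = w" "\<forall>j<l. (par ^^ j) v \<noteq> r" using assms by (auto simp: tle_def)
  have shift: "(par ^^ (j + k)) u = (par ^^ j) v" for j
    using k by (simp add: funpow_add)
  have "(par ^^ j) u \<noteq> r" if "j < l + k" for j
  proof (cases "j < k")
    case False
    then show ?thesis using shift[of "j - k"] l(2) that by auto
  qed (use k in auto)
  then show ?thesis using shift[of l] l assms le_V unfolding tle_def by blast
qed

lemma le_root: assumes "v \<in> V" shows "v \<sqsubseteq> r"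
proof -
  define k where "k = (LEAST k. (par ^^ k) v = r)"
  have "(par ^^ k) v = r" unfolding k_def using LeastI_ex[OF reaches_root[OF assms]] .
  moreover have "\<forall>j<k. (par ^^ j) v \<noteq> r" unfolding k_def using not_less_Least by blast
  ultimately show ?thesis using assms root_in_V unfolding tle_def by blast
qed

text \<open>The number \<open>d x\<close> of steps to the root never grows along the order and drops
  strictly between distinct nodes. This relies on the clause in \<open>tle\<close> that a path does
  not continue past \<open>r\<close>, since \<open>par r\<close> is arbitrary.\<close>

lemma le_antisym: assumes "u \<sqsubseteq> v" "v \<sqsubseteq> u" shows "u = v"
proof -
  define d where "d x = (LEAST k. (par ^^ k) x = r)" for x
  have d: "(par ^^ d x) x = r" if "x \<in> V" for x
    unfolding d_def using LeastI_ex[OF reaches_root[OF that]] .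
  have dle: "d x \<le> k" if "(par ^^ k) x = r" for x k
    unfolding d_def using that by (rule Least_le)
  have *: "d y \<le> d x" "d x = d y \<Longrightarrow> x = y" if "x \<sqsubseteq> y" for x y
  proof -
    obtain k where k: "(par ^^ k) x = y" "\<forall>j<k. (par ^^ j) x \<noteq> r" using \<open>x \<sqsubseteq> y\<close> by (auto simp: tle_def)
    have "d x \<ge> k" using d[of x] k le_V[OF \<open>x \<sqsubseteq> y\<close>] by (meson not_le)
    then have "(par ^^ (d x - k)) y = r"
      using k d[of x] le_V[OF \<open>x \<sqsubseteq> y\<close>]
      by (metis comp_apply funpow_add le_add_diff_inverse2)
    then have le: "d y \<le> d x - k" by (rule dle)
    then show "d y \<le> d x" by simp
    show "x = y" if "d x = d y"
    proof (cases "k = 0")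
      case False
      then have "d x = 0" using le that \<open>d x \<ge> k\<close> by arith
      then show ?thesis using \<open>d x \<ge> k\<close> False by simp
    qed (use k in simp)
  qed
  show ?thesis using *(2)[OF assms(1)] order.antisym[OF *(1)[OF assms(2)] *(1)[OF assms(1)]] by blast
qed

lemma le_linear: assumes "u \<sqsubseteq> v" "u \<sqsubseteq> w" shows "v \<sqsubseteq> w \<or> w \<sqsubseteq> v"
proof -
  have *: "x \<sqsubseteq> y" if "(par ^^ k) u = x" "(par ^^ l) u = y" "\<forall>j<l. (par ^^ j) u \<noteq> r" "k \<le> l" "x \<in> V" "y \<in> V"
    for x y k l
  proof -
    have shift: "(par ^^ j) x = (par ^^ (j + k)) u" for j
      using that by (simp add: funpow_add)
    have "(par ^^ (l - k)) x = y" using shift[of "l - k"] that by simp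
    moreover have "\<forall>j<l-k. (par ^^ j) x \<noteq> r" using shift that by auto
    ultimately show ?thesis using that unfolding tle_def by blast
  qed
  obtain k where k: "(par ^^ k) u = v" "\<forall>j<k. (par ^^ j) u \<noteq> r" using assms by (auto simp: tle_def)
  obtain l where l: "(par ^^ l) u = w" "\<forall>j<l. (par ^^ j) u \<noteq> r" using assms by (auto simp: tle_def)
  show ?thesis
    using *[OF k(1) l] *[OF l(1) k] le_V[OF assms(1)] le_V[OF assms(2)] by (cases "k \<le> l") auto
qed

lemma lt_par: assumes "u \<in> V" "u \<noteq> r" shows "u \<sqsubset> par u"
proof -
  have le: "u \<sqsubseteq> par u" using assms par_in_V unfolding tle_def by (auto intro: exI[of _ 1])
  have "par u \<noteq> u"
  proof
    assume "par u = u"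
    then have "(par ^^ k) u = u" for k by (induction k) auto
    then show False using reaches_root[OF assms(1)] assms(2) by auto
  qed
  then show ?thesis using le by (auto simp: tlt_def)
qed

lemma par_le: assumes "u \<sqsubset> v" shows "u \<noteq> r" "par u \<sqsubseteq> v"
proof -
  obtain k where k: "(par ^^ k) u = v" "\<forall>j<k. (par ^^ j) u \<noteq> r" "u \<in> V" "v \<in> V" "u \<noteq> v"
    using assms by (auto simp: tle_def tlt_def)
  then obtain l where l: "k = Suc l" by (cases k) auto
  show "u \<noteq> r" using k l by auto
  then have "par u \<in> V" using k par_in_V by auto
  moreover have "(par ^^ l) (par u) = v" using k l by (simp add: funpow_swap1)
  moreover have "\<forall>j<l. (par ^^ j) (par u) \<noteq> r" using k(2) l
    by (metis Suc_less_eq funpow_simps_right(2) comp_apply)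
  ultimately show "par u \<sqsubseteq> v" using k unfolding tle_def by blast
qed

lemma lt_le: "u \<sqsubset> v \<Longrightarrow> u \<sqsubseteq> v" by (simp add: tlt_def)
lemma le_lt_trans: "u \<sqsubseteq> v \<Longrightarrow> v \<sqsubset> w \<Longrightarrow> u \<sqsubset> w"
  unfolding tlt_def using le_trans le_antisym by blast
lemma lt_le_trans: "u \<sqsubset> v \<Longrightarrow> v \<sqsubseteq> w \<Longrightarrow> u \<sqsubset> w"
  unfolding tlt_def using le_trans le_antisym by blast
lemma lt_irrefl: "\<not> u \<sqsubset> u" by (simp add: tlt_def)
lemma le_cases: "u \<sqsubseteq> v \<Longrightarrow> u = v \<or> u \<sqsubset> v" by (auto simp: tlt_def)
lemma comparable: "u \<sqsubseteq> v \<Longrightarrow> u \<sqsubseteq> w \<Longrightarrow> v \<sqsubseteq> w \<or> w \<sqsubset> v"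
  using le_linear by (metis le_cases le_refl le_V(2))

lemma dn_iff [simp]: "u \<in> dn v \<longleftrightarrow> u \<sqsubseteq> v"
  using le_V by (auto simp: down_def)

lemma up_iff [simp]: "u \<in> up V par r v \<longleftrightarrow> v \<sqsubseteq> u"
  using le_V by (auto simp: up_def)

lemma finite_dn: "finite (dn v)" and finite_up: "finite (up V par r v)"
  using finite_V by (auto simp: down_def up_def)

section \<open>Depth and extremal nodes\<close>

lemma depth_par: assumes "u \<in> V" "u \<noteq> r" shows "dep u = Suc (dep (par u))"
proof -
  have lt: "u \<sqsubset> par u" using lt_par assms by auto
  have "up V par r u = insert u (up V par r (par u))"
  proof (intro set_eqI iffI)
    fix x assume "x \<in> up V par r u"
    then show "x \<in> insert u (up V par r (par u))" using par_le(2)[of u x] le_cases by auto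
  next
    fix x assume "x \<in> insert u (up V par r (par u))"
    then show "x \<in> up V par r u" using lt_le[OF lt] le_refl assms le_trans by auto
  qed
  moreover have "u \<notin> up V par r (par u)" using lt le_antisym by (auto simp: tlt_def)
  ultimately have "card (up V par r u) = Suc (card (up V par r (par u)))"
    using finite_up by simp
  moreover have "par u \<in> up V par r (par u)" using le_refl le_V(2)[OF lt_le[OF lt]] by simp
  then have "card (up V par r (par u)) > 0" using finite_up card_gt_0_iff by blast
  ultimately show ?thesis unfolding depth_def by simp
qed

lemma depth_root: "dep r = 0"
proof -
  have "up V par r r = {r}" using le_refl root_in_V le_root le_antisym le_V by auto
  then show ?thesis by (simp add: depth_def)
qed

lemma depth_less: assumes "u \<sqsubset> v" shows "dep v < dep u"
proof -
  have "up V par r v \<subset> up V par r u"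
  proof
    show "up V par r v \<subseteq> up V par r u" using le_trans[OF lt_le[OF assms]] by auto
    have "u \<in> up V par r u" "u \<notin> up V par r v"
      using le_refl le_V(1)[OF lt_le[OF assms]] le_lt_trans[OF _ assms] lt_irrefl by auto
    then show "up V par r v \<noteq> up V par r u" by blast
  qed
  then have "card (up V par r v) < card (up V par r u)" using finite_up psubset_card_mono by blast
  moreover have "card (up V par r v) > 0" using finite_up assms
    by (metis card_gt_0_iff empty_iff le_V(2) le_refl lt_le up_iff)
  ultimately show ?thesis unfolding depth_def by linarith
qed

lemma minimal_elem:
  assumes "D \<subseteq> V" "D \<noteq> {}"
  shows "\<exists>u\<in>D. \<forall>y\<in>D. y \<sqsubseteq> u \<longrightarrow> y = u"
proof -
  have fin: "finite (dep ` D)" using assms finite_V finite_subset by auto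
  then obtain u where u: "u \<in> D" "dep u = Max (dep ` D)"
    using Max_in[OF fin] assms by (metis image_iff image_is_empty)
  have "y = u" if "y \<in> D" "y \<sqsubseteq> u" for y
  proof (rule ccontr)
    assume "y \<noteq> u"
    then have "y \<sqsubset> u" using that by (auto simp: tlt_def)
    moreover have "dep y \<le> dep u" using Max_ge[OF fin] u that by auto
    ultimately show False using depth_less by fastforce
  qed
  then show ?thesis using u by blast
qed

lemma maximal_elem:
  assumes "D \<subseteq> V" "D \<noteq> {}"
  shows "\<exists>u\<in>D. \<forall>y\<in>D. u \<sqsubseteq> y \<longrightarrow> y = u"
proof -
  have fin: "finite (dep ` D)" using assms finite_V finite_subset by auto
  then obtain u where u: "u \<in> D" "dep u = Min (dep ` D)"
    using Min_in[OF fin] assms by (metis image_iff image_is_empty)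
  have "y = u" if "y \<in> D" "u \<sqsubseteq> y" for y
  proof (rule ccontr)
    assume "y \<noteq> u"
    then have "u \<sqsubset> y" using that by (auto simp: tlt_def)
    moreover have "dep u \<le> dep y" using Min_le[OF fin] u that by auto
    ultimately show False using depth_less by fastforce
  qed
  then show ?thesis using u by blast
qed

subsection \<open>Ornamentations\<close>

text \<open>A walk can leave the part below a node \<open>z\<close> only through \<open>z\<close>,
  so connectedness up to the top \<open>v\<close> amounts to containing all nodes between a member
  and \<open>v\<close>. The left-hand side repeats the wording of \<open>ornamentation\<close> so
  that it can be rewritten there.\<close>

lemma ornament_iff:
  assumes "v \<in> V"
  shows "(ornament V par r S \<and> v \<in> S \<and> (\<forall>u\<in>S. \<not> v \<sqsubset> u) \<and>
          (\<forall>u\<in>S. (\<forall>w\<in>S. \<not> u \<sqsubset> w) \<longrightarrow> u = v)) \<longleftrightarrow>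
    v \<in> S \<and> S \<subseteq> dn v \<and> (\<forall>u\<in>S. \<forall>z. u \<sqsubseteq> z \<longrightarrow> z \<sqsubseteq> v \<longrightarrow> z \<in> S)" (is "?L \<longleftrightarrow> ?R")
proof
  assume L: ?L
  have SV: "S \<subseteq> V" using L by (auto simp: ornament_def)
  have sub: "u \<sqsubseteq> v" if "u \<in> S" for u
  proof -
    let ?D = "{y \<in> S. u \<sqsubseteq> y}"
    have "?D \<subseteq> V" "?D \<noteq> {}" using that SV le_refl by auto
    then obtain m where m: "m \<in> ?D" "\<forall>y\<in>?D. m \<sqsubseteq> y \<longrightarrow> y = m"
      using maximal_elem[of ?D] by blast
    have "\<forall>w\<in>S. \<not> m \<sqsubset> w"
    proof (intro ballI notI)
      fix w assume w: "w \<in> S" "m \<sqsubset> w"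
      then have "w \<in> ?D" using m(1) le_trans lt_le by blast
      then show False using m(2) w lt_le lt_irrefl by blast
    qed
    then have "m = v" using L m(1) by auto
    then show ?thesis using m(1) by simp
  qed
  have conv: "z \<in> S" if "u \<in> S" "u \<sqsubseteq> z" "z \<sqsubseteq> v" for u z
  proof (rule ccontr)
    assume z: "z \<notin> S"
    have "(\<lambda>a b. a \<in> S \<and> b \<in> S \<and> tadj V par r a b)\<^sup>*\<^sup>* u v"
      using L that(1) by (auto simp: ornament_def)
    \<comment> \<open>Invariant of the walk: it stays below \<open>z\<close>, because an upward step
      cannot pass \<open>z\<close> while \<open>z\<close> is outside \<open>S\<close>.\<close>
    then have "v \<sqsubseteq> z"
    proof induction
      case (step a b)
      then have "a \<sqsubset> z" using z le_cases by auto
      from step(2) show ?case unfolding tadj_def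
      proof (elim conjE disjE)
        assume "b = par a" then show ?thesis using par_le \<open>a \<sqsubset> z\<close> by auto
      next
        assume "b \<in> V" "b \<noteq> r" "a = par b"
        then show ?thesis using lt_par lt_le le_trans step.IH by blast
      qed
    qed (use that in simp)
    then show False using that le_antisym z L by auto
  qed
  have "S \<subseteq> dn v" using sub dn_iff by blast
  then show ?R using L conv by blast
next
  assume R: ?R
  have SV: "S \<subseteq> V" using R le_V by auto
  let ?E = "\<lambda>a b. a \<in> S \<and> b \<in> S \<and> tadj V par r a b"
  have up: "u \<in> S \<Longrightarrow> ?E\<^sup>*\<^sup>* u v" for u
  proof (induction "dep u" arbitrary: u rule: less_induct)
    case less
    show ?case
    proof (cases "u = v")
      case False
      then have lt: "u \<sqsubset> v" using R less.prems by (auto simp: tlt_def)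
      then have "u \<noteq> r" "par u \<sqsubseteq> v" using par_le by auto
      moreover have uV: "u \<in> V" using SV less.prems by auto
      moreover have l2: "u \<sqsubset> par u" using lt_par calculation by auto
      ultimately have parS: "par u \<in> S" using R less.prems lt_le by blast
      then have "?E u (par u)" using \<open>u \<noteq> r\<close> uV less.prems by (simp add: tadj_def)
      then show ?thesis
        using less.hyps[OF depth_less[OF l2] parS] by (rule converse_rtranclp_into_rtranclp[of ?E])
    qed simp
  qed
  have sym: "symp ?E" by (auto simp: symp_def tadj_def)
  have down: "?E\<^sup>*\<^sup>* v u" if "u \<in> S" for u
    using up[OF that] sympD[OF symp_rtranclp[OF sym]] by blast
  have "ornament V par r S"
    unfolding ornament_def
  proof (intro conjI ballI)
    fix x y assume "x \<in> S" "y \<in> S"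
    then show "?E\<^sup>*\<^sup>* x y" using rtranclp_trans[OF up down] by simp
  qed (use R SV in auto)
  moreover have below: "u \<sqsubseteq> v" if "u \<in> S" for u
    using R that dn_iff by blast
  then have "\<not> v \<sqsubset> u" if "u \<in> S" for u
    using le_lt_trans[OF below[OF that], of u] lt_irrefl by blast
  moreover have "u = v" if "u \<in> S" "\<forall>w\<in>S. \<not> u \<sqsubset> w" for u
    using R that le_cases[OF below] by blast
  ultimately show ?L using R by blast
qed

text \<open>Two ornaments with a common node have comparable tops, and convexity then puts the lower
  top into the other ornament. So only members \<open>u\<close> of \<open>\<delta> v\<close> have to
  be tested for nesting.\<close>

lemma orn_iff:
  "orn \<delta> \<longleftrightarrow> (\<forall>v. v \<notin> V \<longrightarrow> \<delta> v = {}) \<and>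
    (\<forall>v\<in>V. v \<in> \<delta> v \<and> \<delta> v \<subseteq> dn v \<and> (\<forall>u\<in>\<delta> v. \<forall>z. u \<sqsubseteq> z \<longrightarrow> z \<sqsubseteq> v \<longrightarrow> z \<in> \<delta> v)
      \<and> (\<forall>u\<in>\<delta> v. \<delta> u \<subseteq> \<delta> v))" (is "_ \<longleftrightarrow> ?R")
proof -
  let ?shape = "\<lambda>v. v \<in> \<delta> v \<and> \<delta> v \<subseteq> dn v \<and> (\<forall>u\<in>\<delta> v. \<forall>z. u \<sqsubseteq> z \<longrightarrow> z \<sqsubseteq> v \<longrightarrow> z \<in> \<delta> v)"
  let ?lam = "\<forall>v\<in>V. \<forall>v'\<in>V. \<delta> v \<subseteq> \<delta> v' \<or> \<delta> v' \<subseteq> \<delta> v \<or> \<delta> v \<inter> \<delta> v' = {}"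
  have "orn \<delta> \<longleftrightarrow> (\<forall>v. v \<notin> V \<longrightarrow> \<delta> v = {}) \<and> (\<forall>v\<in>V. ?shape v) \<and> ?lam"
    unfolding ornamentation_def using ornament_iff by (simp cong: ball_cong)
  also have "\<dots> \<longleftrightarrow> (\<forall>v. v \<notin> V \<longrightarrow> \<delta> v = {}) \<and> (\<forall>v\<in>V. ?shape v) \<and> (\<forall>v\<in>V. \<forall>u\<in>\<delta> v. \<delta> u \<subseteq> \<delta> v)"
  proof (intro conj_cong refl)
    assume shape: "\<forall>v\<in>V. ?shape v"
    have self: "v \<in> \<delta> v" if "v \<in> V" for v using shape that by blast
    have below: "u \<sqsubseteq> v" if "v \<in> V" "u \<in> \<delta> v" for u v using shape that dn_iff by blast
    have conv: "z \<in> \<delta> v" if "v \<in> V" "u \<in> \<delta> v" "u \<sqsubseteq> z" "z \<sqsubseteq> v" for u v z using shape that by blast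
    show "?lam \<longleftrightarrow> (\<forall>v\<in>V. \<forall>u\<in>\<delta> v. \<delta> u \<subseteq> \<delta> v)"
    proof
      assume lam: ?lam
      show "\<forall>v\<in>V. \<forall>u\<in>\<delta> v. \<delta> u \<subseteq> \<delta> v"
      proof (intro ballI)
        fix v u assume v: "v \<in> V" "u \<in> \<delta> v"
        have uv: "u \<sqsubseteq> v" using below v by simp
        then have uV: "u \<in> V" using le_V by simp
        have "u \<in> \<delta> u \<inter> \<delta> v" using v uV self by simp
        moreover have "u = v" if "\<delta> v \<subseteq> \<delta> u"
          using that below[OF uV] self[OF v(1)] uv le_antisym by blast
        ultimately show "\<delta> u \<subseteq> \<delta> v" using lam v(1) uV by (metis empty_iff)
      qed
    next
      assume nest: "\<forall>v\<in>V. \<forall>u\<in>\<delta> v. \<delta> u \<subseteq> \<delta> v"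
      have sub: "\<delta> v \<subseteq> \<delta> v'" if "v \<in> V" "v' \<in> V" "x \<in> \<delta> v" "x \<in> \<delta> v'" "v \<sqsubseteq> v'" for v v' x
        using conv[OF that(2,4) below[OF that(1,3)] that(5)] nest that(2) by simp
      show ?lam
      proof (intro ballI)
        fix v v' assume vv: "v \<in> V" "v' \<in> V"
        show "\<delta> v \<subseteq> \<delta> v' \<or> \<delta> v' \<subseteq> \<delta> v \<or> \<delta> v \<inter> \<delta> v' = {}"
        proof (cases "\<delta> v \<inter> \<delta> v' = {}")
          case False
          then obtain x where x: "x \<in> \<delta> v" "x \<in> \<delta> v'" by auto
          then have "v \<sqsubseteq> v' \<or> v' \<sqsubseteq> v" using le_linear[OF below[OF vv(1)] below[OF vv(2)]] by simp
          then show ?thesis using sub[OF vv x] sub[OF vv(2,1) x(2,1)] by auto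
        qed simp
      qed
    qed
  qed
  also have "\<dots> \<longleftrightarrow> ?R" by blast
  finally show ?thesis .
qed

text \<open>Cited below as a numbered list, usually \<open>o\<close>: (1) and (2) membership in
  \<open>V\<close>, (3) the top, (4) the bound by the top, (5) convexity, (6) nesting.\<close>

lemma ornD:
  assumes "orn \<delta>"
  shows orn_V: "x \<in> \<delta> v \<Longrightarrow> v \<in> V" "x \<in> \<delta> v \<Longrightarrow> x \<in> V"
    and orn_self: "v \<in> V \<Longrightarrow> v \<in> \<delta> v"
    and orn_le: "x \<in> \<delta> v \<Longrightarrow> x \<sqsubseteq> v"
    and orn_conv: "x \<in> \<delta> v \<Longrightarrow> x \<sqsubseteq> z \<Longrightarrow> z \<sqsubseteq> v \<Longrightarrow> z \<in> \<delta> v"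
    and orn_nest: "u \<in> \<delta> v \<Longrightarrow> \<delta> u \<subseteq> \<delta> v"
proof -
  note 1 = assms[unfolded orn_iff, THEN conjunct1, rule_format]
  note 2 = assms[unfolded orn_iff, THEN conjunct2, THEN bspec]
  show a: "x \<in> \<delta> v \<Longrightarrow> v \<in> V" for x v using 1 by (metis empty_iff)
  show b: "x \<in> \<delta> v \<Longrightarrow> x \<sqsubseteq> v" for x v using 2[of v] a dn_iff by blast
  show "x \<in> \<delta> v \<Longrightarrow> x \<in> V" using b le_V by blast
  show "v \<in> V \<Longrightarrow> v \<in> \<delta> v" using 2[of v] by blast
  show "x \<in> \<delta> v \<Longrightarrow> x \<sqsubseteq> z \<Longrightarrow> z \<sqsubseteq> v \<Longrightarrow> z \<in> \<delta> v" using 2[of v] a by blast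
  show "u \<in> \<delta> v \<Longrightarrow> \<delta> u \<subseteq> \<delta> v" using 2[of v] a by blast
qed

subsection \<open>The pop-stack operator\<close>

text \<open>The lower covers of \<open>\<delta>\<close> arise by deleting from some \<open>\<delta> v\<close> a maximal inner ornament
  \<open>\<delta> u\<close> below which \<open>\<delta> v\<close> contains nothing else; \<open>removable \<delta> v u\<close> says that this is possible.\<close>

definition removable :: "('a \<Rightarrow> 'a set) \<Rightarrow> 'a \<Rightarrow> 'a \<Rightarrow> bool" where
  "removable \<delta> v u \<longleftrightarrow> u \<in> \<delta> v \<and> u \<noteq> v \<and> dn u \<inter> \<delta> v = \<delta> u \<and>
     (\<forall>z. u \<sqsubset> z \<longrightarrow> z \<sqsubset> v \<longrightarrow> u \<notin> \<delta> z)"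

lemma maximal_inner_ornament:
  assumes "orn \<delta>" "p \<in> \<delta> v" "p \<noteq> v"
  shows "\<exists>q. p \<in> \<delta> q \<and> q \<in> \<delta> v \<and> q \<noteq> v \<and> (\<forall>z. q \<sqsubset> z \<longrightarrow> z \<sqsubset> v \<longrightarrow> p \<notin> \<delta> z)"
proof -
  note o = ornD[OF assms(1)]
  let ?D = "{q. p \<in> \<delta> q \<and> q \<sqsubset> v}"
  have pv: "p \<sqsubset> v" using o(4)[OF assms(2)] assms(3) by (simp add: tlt_def)
  have "p \<in> ?D" using pv o(3)[OF o(2)[OF assms(2)]] by simp
  moreover have "?D \<subseteq> V" using o(1) by blast
  ultimately obtain q where q: "q \<in> ?D" "\<forall>y\<in>?D. q \<sqsubseteq> y \<longrightarrow> y = q"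
    using maximal_elem[of ?D] by blast
  have "p \<notin> \<delta> z" if "q \<sqsubset> z" "z \<sqsubset> v" for z
    using q(2) that lt_le lt_irrefl by blast
  moreover have "q \<in> \<delta> v" using o(5)[OF assms(2) o(4)] q(1) lt_le by blast
  ultimately show ?thesis using q(1) lt_irrefl by blast
qed

text \<open>A minimal \<open>?free\<close> node \<open>u\<close> of \<open>D\<close> works: a node
  of \<open>\<delta> v\<close> below \<open>u\<close> lies in the ornament of some free
  \<open>q\<close> in \<open>D\<close>, this \<open>q\<close> cannot lie above \<open>u\<close>, and
  minimality forces \<open>q = u\<close>. The closure conditions keep these nodes inside
  \<open>D\<close>.\<close>

lemma ex_removable:
  assumes "orn \<delta>" "D \<subseteq> \<delta> v" "v \<notin> D" "D \<noteq> {}"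
    and closed: "\<And>p y. p \<in> D \<Longrightarrow> y \<in> \<delta> v \<Longrightarrow> y \<sqsubseteq> p \<Longrightarrow> y \<in> D"
      "\<And>p q. p \<in> D \<Longrightarrow> p \<in> \<delta> q \<Longrightarrow> q \<in> \<delta> v \<Longrightarrow> q \<noteq> v \<Longrightarrow> q \<in> D"
  shows "\<exists>u\<in>D. removable \<delta> v u"
proof -
  note o = ornD[OF assms(1)]
  let ?free = "\<lambda>u. \<forall>z. u \<sqsubset> z \<longrightarrow> z \<sqsubset> v \<longrightarrow> u \<notin> \<delta> z"
  have top: "\<exists>q\<in>D. p \<in> \<delta> q \<and> ?free q" if "p \<in> D" for p
  proof -
    have "p \<in> \<delta> v" "p \<noteq> v" using that assms(2,3) by auto
    then obtain q where q: "p \<in> \<delta> q" "q \<in> \<delta> v" "q \<noteq> v" "\<forall>z. q \<sqsubset> z \<longrightarrow> z \<sqsubset> v \<longrightarrow> p \<notin> \<delta> z"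
      using maximal_inner_ornament[OF assms(1)] by blast
    then have "?free q" using o(6)[of q] by blast
    then show ?thesis using q closed(2) that by blast
  qed
  let ?E = "{u \<in> D. ?free u}"
  have "?E \<noteq> {}" using top assms(4) by blast
  moreover have "?E \<subseteq> V" using assms(2) o(2)[of _ v] by blast
  ultimately obtain u where u: "u \<in> ?E" "\<forall>y\<in>?E. y \<sqsubseteq> u \<longrightarrow> y = u"
    using minimal_elem[of ?E] by blast
  have uv: "u \<in> \<delta> v" "u \<noteq> v" using u assms(2,3) by auto
  have "p \<in> \<delta> u" if p: "p \<sqsubseteq> u" "p \<in> \<delta> v" for p
  proof -
    have "p \<in> D" using closed(1) u p by blast
    then obtain q where q: "q \<in> D" "p \<in> \<delta> q" "?free q" using top by blast
    have "q \<sqsubset> v" using q(1) assms(2,3) o(4) by (auto simp: tlt_def)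
    have "\<not> u \<sqsubset> q"
    proof
      assume "u \<sqsubset> q"
      then have "u \<in> \<delta> q" using o(5)[OF q(2) p(1)] lt_le by simp
      then show False using u(1) \<open>q \<sqsubset> v\<close> \<open>u \<sqsubset> q\<close> by simp
    qed
    then have "q \<sqsubseteq> u" using comparable[OF o(4)[OF q(2)] p(1)] by blast
    then have "q = u" using u(2) q by blast
    then show ?thesis using q by simp
  qed
  then have "dn u \<inter> \<delta> v = \<delta> u" using o(4)[of _ u] o(6)[OF uv(1)] by auto
  then show ?thesis using u uv unfolding removable_def by blast
qed

text \<open>If the two ornaments met, \<open>y\<close> would lie strictly above \<open>u\<close>,
  and by convexity its ornament would contain \<open>u\<close>, against the last clause of
  \<open>removable\<close>.\<close>

lemma removable_disjoint:
  assumes "orn \<delta>" "removable \<delta> v u" "y \<in> \<delta> v" "y \<noteq> v" "y \<notin> \<delta> u"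
  shows "\<delta> y \<inter> \<delta> u = {}"
proof (rule ccontr)
  note o = ornD[OF assms(1)]
  assume "\<delta> y \<inter> \<delta> u \<noteq> {}"
  then obtain x where x: "x \<in> \<delta> y" "x \<in> \<delta> u" by blast
  have "\<not> y \<sqsubseteq> u" using assms(2,3,5) unfolding removable_def by auto
  then have "u \<sqsubset> y" using comparable[OF o(4)[OF x(1)] o(4)[OF x(2)]] by blast
  moreover have "y \<sqsubset> v" using assms(3,4) o(4) by (simp add: tlt_def)
  ultimately show False
    using assms(2) o(5)[OF x(1) o(4)[OF x(2)] lt_le] unfolding removable_def by blast
qed

lemma removable_below:
  assumes "orn \<delta>" "removable \<delta> v u" "x \<in> \<delta> v" "x \<sqsubseteq> z" "z \<in> \<delta> u"
  shows "x \<in> \<delta> u"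
  using assms ornD(4)[OF assms(1), of z u] le_trans[of x z u] unfolding removable_def by auto

text \<open>The arbitrary relation \<open>R\<close> covers both uses: a single removal gives a lower
  cover, all removals at once give \<open>Pop\<close>.\<close>

lemma orn_remove:
  assumes "orn \<delta>" and rem: "\<And>v u. R v u \<Longrightarrow> removable \<delta> v u"
  shows "orn (\<lambda>v. \<delta> v - (\<Union>u\<in>{u. R v u}. \<delta> u))" (is "orn ?\<gamma>")
proof -
  note o = ornD[OF assms(1)]
  have lt: "u \<sqsubset> v" if "R v u" for u v
    using rem[OF that] o(4) by (simp add: removable_def tlt_def)
  have self: "v \<in> ?\<gamma> v" if "v \<in> V" for v
    using o(3)[OF that] lt[of v] le_lt_trans[OF o(4), of v _ v] lt_irrefl[of v] by blast
  have conv: "z \<in> ?\<gamma> v" if "x \<in> ?\<gamma> v" "x \<sqsubseteq> z" "z \<sqsubseteq> v" for x z v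
    using that o(5)[of x v z] removable_below[OF assms(1) rem, of v _ x z] by blast
  have nest: "?\<gamma> y \<subseteq> ?\<gamma> v" if "y \<in> ?\<gamma> v" for y v
  proof (cases "y = v")
    case False
    have "\<delta> y \<inter> \<delta> u = {}" if "R v u" for u
      using removable_disjoint[OF assms(1) rem[OF that], of y] False that \<open>y \<in> ?\<gamma> v\<close> by blast
    then show ?thesis using o(6)[of y v] that by blast
  qed simp
  have out: "?\<gamma> v = {}" if "v \<notin> V" for v using o(1) that by blast
  have below: "?\<gamma> v \<subseteq> dn v" for v using o(4) by auto
  show ?thesis unfolding orn_iff
  proof (intro conjI allI ballI impI)
    fix v u z assume "u \<in> ?\<gamma> v" "u \<sqsubseteq> z" "z \<sqsubseteq> v"
    then show "z \<in> ?\<gamma> v" by (rule conv)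
  next
    fix v u assume "u \<in> ?\<gamma> v"
    then show "?\<gamma> u \<subseteq> ?\<gamma> v" by (rule nest)
  next
    fix v show "?\<gamma> v \<subseteq> dn v" by (rule below)
  qed (fact self out)+
qed

section \<open>Lower covers and the explicit form of the operator\<close>

lemma orn_remove1:
  assumes "orn \<delta>" "removable \<delta> v u"
  shows "orn (\<delta>(v := \<delta> v - \<delta> u))"
proof -
  have "\<delta>(v := \<delta> v - \<delta> u) = (\<lambda>w. \<delta> w - (\<Union>x\<in>{x. w = v \<and> x = u}. \<delta> x))" by (auto simp: fun_eq_iff)
  moreover have "orn \<dots>" by (rule orn_remove[OF assms(1), of "\<lambda>w x. w = v \<and> x = u"]) (use assms(2) in blast)
  ultimately show ?thesis by simp
qed

text \<open>Anything in between agrees with \<open>\<delta>\<close> away from \<open>v\<close>. If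
  its ornament at \<open>v\<close> meets \<open>\<delta> u\<close>, convexity puts \<open>u\<close>
  into it and nesting then all of \<open>\<delta> u\<close>, so nothing is removed.\<close>

lemma removable_cover:
  assumes "orn \<delta>" "removable \<delta> v u"
  shows "ocover V par r (\<delta>(v := \<delta> v - \<delta> u)) \<delta>" (is "ocover V par r ?\<delta>' \<delta>")
proof -
  note o = ornD[OF assms(1)]
  have u: "u \<in> \<delta> u" "u \<in> \<delta> v" "u \<noteq> v"
    using assms(2) o(3)[OF o(2), of u v] unfolding removable_def by blast+
  have "\<gamma> = ?\<delta>' \<or> \<gamma> = \<delta>" if \<gamma>: "orn \<gamma>" "ole V ?\<delta>' \<gamma>" "ole V \<gamma> \<delta>" for \<gamma>
  proof -
    note g = ornD[OF \<gamma>(1)]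
    have sub: "\<gamma> y \<subseteq> \<delta> y" "?\<delta>' y \<subseteq> \<gamma> y" for y
      using \<gamma>(2,3) o(1)[of _ y] g(1)[of _ y] unfolding ole_def
      by (fastforce split: if_splits)+
    have other: "\<gamma> y = \<delta> y" if "y \<noteq> v" for y using sub[of y] that by auto
    show ?thesis
    proof (cases "\<gamma> v \<inter> \<delta> u = {}")
      case True
      then have "\<gamma> v = \<delta> v - \<delta> u" using sub[of v] by auto
      then show ?thesis using other by (auto simp: fun_eq_iff)
    next
      case False
      then obtain x where x: "x \<in> \<gamma> v" "x \<in> \<delta> u" by blast
      have "u \<in> \<gamma> v" using g(5)[OF x(1) o(4)[OF x(2)] o(4)[OF u(2)]] .
      then have "\<delta> u \<subseteq> \<gamma> v" using g(6)[of u v] other u by auto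
      then have "\<gamma> v = \<delta> v" using sub[of v] by auto
      then show ?thesis using other by (simp add: fun_eq_iff) metis
    qed
  qed
  moreover have "?\<delta>' \<noteq> \<delta>" using u by (metis DiffD2 fun_upd_same)
  ultimately show ?thesis
    using orn_remove1[OF assms] assms unfolding ocover_def Orn_def ole_def by auto
qed

text \<open>At a minimal node \<open>v\<close> where the two differ, all inner ornaments agree, so
  the nodes missing from \<open>\<gamma> v\<close> satisfy the closure conditions of
  \<open>ex_removable\<close>.\<close>

lemma less_imp_le_remove:
  assumes "orn \<delta>" "orn \<gamma>" "ole V \<gamma> \<delta>" "\<gamma> \<noteq> \<delta>"
  shows "\<exists>v u. removable \<delta> v u \<and> ole V \<gamma> (\<delta>(v := \<delta> v - \<delta> u))"
proof -
  note o = ornD[OF assms(1)] and g = ornD[OF assms(2)]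
  have sub: "\<gamma> y \<subseteq> \<delta> y" for y using assms(3) g(1)[of _ y] unfolding ole_def by blast
  let ?D = "{v. \<gamma> v \<noteq> \<delta> v}"
  have ne: "?D \<noteq> {}" using assms(4) by auto
  have V: "v \<in> V" if "\<gamma> v \<noteq> \<delta> v" for v using o(1)[of _ v] g(1)[of _ v] that by blast
  then have "?D \<subseteq> V" by blast
  then obtain v where v: "\<gamma> v \<noteq> \<delta> v" "\<forall>y. \<gamma> y \<noteq> \<delta> y \<longrightarrow> y \<sqsubseteq> v \<longrightarrow> y = v"
    using minimal_elem[OF _ ne] by blast
  have vV: "v \<in> V" using v(1) V by blast
  have low: "\<gamma> y = \<delta> y" if "y \<in> \<delta> v" "y \<noteq> v" for y using v(2) o(4)[OF that(1)] that(2) by blast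
  have "\<exists>u\<in>\<delta> v - \<gamma> v. removable \<delta> v u"
  proof (rule ex_removable[OF assms(1)])
    show "v \<notin> \<delta> v - \<gamma> v" using g(3)[OF vV] by blast
    show "\<delta> v - \<gamma> v \<noteq> {}" using v(1) sub[of v] by blast
    show "y \<in> \<delta> v - \<gamma> v" if "p \<in> \<delta> v - \<gamma> v" "y \<in> \<delta> v" "y \<sqsubseteq> p" for p y
      using that g(5)[of y v p] o(4)[of p v] by blast
    show "q \<in> \<delta> v - \<gamma> v" if "p \<in> \<delta> v - \<gamma> v" "p \<in> \<delta> q" "q \<in> \<delta> v" "q \<noteq> v" for p q
      using that low[of q] g(6)[of q v] by blast
  qed auto
  then obtain u where u: "u \<notin> \<gamma> v" "removable \<delta> v u" by blast
  have "u \<in> \<delta> v" using u(2) unfolding removable_def by blast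
  have "x \<notin> \<delta> u" if "x \<in> \<gamma> v" for x
    using g(5)[OF that, of u] o(4)[of _ u] o(4)[OF \<open>u \<in> \<delta> v\<close>] u(1) by blast
  then have "\<gamma> v \<subseteq> \<delta> v - \<delta> u" using sub[of v] by blast
  then have "ole V \<gamma> (\<delta>(v := \<delta> v - \<delta> u))" using sub unfolding ole_def by auto
  then show ?thesis using u by blast
qed

lemma ocover_iff:
  assumes "orn \<delta>"
  shows "ocover V par r \<delta>' \<delta> \<longleftrightarrow> (\<exists>v u. removable \<delta> v u \<and> \<delta>' = \<delta>(v := \<delta> v - \<delta> u))"
proof
  assume c: "ocover V par r \<delta>' \<delta>"
  then have "orn \<delta>'" "ole V \<delta>' \<delta>" "\<delta>' \<noteq> \<delta>" unfolding ocover_def Orn_def by auto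
  then obtain v u where vu: "removable \<delta> v u" "ole V \<delta>' (\<delta>(v := \<delta> v - \<delta> u))"
    using less_imp_le_remove[OF assms] by blast
  have "ocover V par r (\<delta>(v := \<delta> v - \<delta> u)) \<delta>" by (rule removable_cover[OF assms vu(1)])
  then have "\<delta>' = \<delta>(v := \<delta> v - \<delta> u)" using c vu(2) unfolding ocover_def by metis
  then show "\<exists>v u. removable \<delta> v u \<and> \<delta>' = \<delta>(v := \<delta> v - \<delta> u)" using vu by blast
qed (use removable_cover[OF assms] in blast)

lemma Pop_eq:
  assumes "orn \<delta>"
  shows "pop \<delta> = (\<lambda>v. \<delta> v - (\<Union>u\<in>{u. removable \<delta> v u}. \<delta> u))"
proof (rule ext)
  fix v
  show "pop \<delta> v = \<delta> v - (\<Union>u\<in>{u. removable \<delta> v u}. \<delta> u)"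
  proof (intro equalityI subsetI)
    fix x assume x: "x \<in> pop \<delta> v"
    have "x \<notin> \<delta> u" if "removable \<delta> v u" for u
    proof -
      have "x \<in> (\<delta>(v := \<delta> v - \<delta> u)) v"
        using x removable_cover[OF assms that] unfolding Pop_def by blast
      then show ?thesis by simp
    qed
    then show "x \<in> \<delta> v - (\<Union>u\<in>{u. removable \<delta> v u}. \<delta> u)" using x by (auto simp: Pop_def)
  next
    fix x assume "x \<in> \<delta> v - (\<Union>u\<in>{u. removable \<delta> v u}. \<delta> u)"
    then show "x \<in> pop \<delta> v" unfolding Pop_def ocover_iff[OF assms] by auto
  qed
qed

lemma orn_Pop: "orn \<delta> \<Longrightarrow> orn (pop \<delta>)"
  unfolding Pop_eq using orn_remove[of \<delta> "removable \<delta>"] by simp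

lemma Pop_le: "pop \<delta> v \<subseteq> \<delta> v"
  by (auto simp: Pop_def)

text \<open>Progress below \<open>w\<close> can be blocked only by an ornament in between with the
  same part below \<open>w\<close>. Without such a blocker some node of \<open>\<delta> x\<close>
  below \<open>w\<close> avoids every ornament in between, and the set \<open>D\<close> of these
  nodes contains a removable one.\<close>

lemma Pop_shrinks_below:
  assumes "orn \<delta>" "w \<in> \<delta> x" "w \<noteq> x"
    and strict: "\<And>z. w \<sqsubset> z \<Longrightarrow> z \<sqsubset> x \<Longrightarrow> w \<in> \<delta> z \<Longrightarrow> \<delta> z \<inter> dn w \<noteq> \<delta> x \<inter> dn w"
  shows "pop \<delta> x \<inter> dn w \<subset> \<delta> x \<inter> dn w"
proof -
  note o = ornD[OF assms(1)]
  have wx: "w \<sqsubset> x" using assms(2,3) o(4) by (simp add: tlt_def)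
  define D where "D = {u \<in> \<delta> x. u \<sqsubseteq> w \<and> (\<forall>z. w \<sqsubset> z \<longrightarrow> z \<sqsubset> x \<longrightarrow> u \<notin> \<delta> z)}"
  have inner: "z \<in> \<delta> x" if "w \<sqsubset> z" "z \<sqsubset> x" for z
    using o(5)[OF assms(2) lt_le lt_le] that by blast
  have "D \<noteq> {}"
  proof (cases "\<exists>z. w \<sqsubset> z \<and> z \<sqsubset> x \<and> w \<in> \<delta> z")
    case True
    let ?Z = "{z. w \<sqsubset> z \<and> z \<sqsubset> x \<and> w \<in> \<delta> z}"
    have "?Z \<subseteq> V" using o(1) by blast
    then obtain z where z: "z \<in> ?Z" "\<forall>y\<in>?Z. z \<sqsubseteq> y \<longrightarrow> y = z"
      using maximal_elem[of ?Z] True by blast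
    have "\<delta> z \<inter> dn w \<subseteq> \<delta> x \<inter> dn w" using inner z(1) o(6)[of z x] by blast
    then obtain u where u: "u \<in> \<delta> x" "u \<sqsubseteq> w" "u \<notin> \<delta> z"
      using strict[of z] z(1) dn_iff by blast
    \<comment> \<open>An ornament in between that contains \<open>u\<close> also contains
      \<open>w\<close>, so by the choice of \<open>z\<close> it is nested in
      \<open>\<delta> z\<close>, which misses \<open>u\<close>.\<close>
    have "u \<notin> \<delta> y" if y: "w \<sqsubset> y" "y \<sqsubset> x" for y
    proof
      assume "u \<in> \<delta> y"
      then have "w \<in> \<delta> y" using o(5)[OF _ u(2) lt_le[OF y(1)]] by blast
      then have "y \<sqsubseteq> z" using z y comparable[of w y z] lt_le[of w y] lt_le[of w z] lt_le[of z y] by blast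
      then have "y \<in> \<delta> z" using o(5)[of w z y] z(1) lt_le[OF y(1)] by blast
      then show False using u(3) \<open>u \<in> \<delta> y\<close> o(6)[of y z] by blast
    qed
    then show ?thesis using u unfolding D_def by blast
  next
    case False
    then show ?thesis using assms(2) le_refl[OF o(2)[OF assms(2)]] unfolding D_def by blast
  qed
  have "\<exists>u\<in>D. removable \<delta> x u"
  proof (rule ex_removable[OF assms(1)])
    show "D \<subseteq> \<delta> x" unfolding D_def by blast
    show "x \<notin> D" using le_lt_trans[OF _ wx, of x] lt_irrefl[of x] unfolding D_def by blast
    show "y \<in> D" if "p \<in> D" "y \<in> \<delta> x" "y \<sqsubseteq> p" for p y
    proof -
      have p: "p \<sqsubseteq> w" "\<And>z. w \<sqsubset> z \<Longrightarrow> z \<sqsubset> x \<Longrightarrow> p \<notin> \<delta> z" using that unfolding D_def by auto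
      have "y \<notin> \<delta> z" if "w \<sqsubset> z" "z \<sqsubset> x" for z
        using p(2)[OF that] o(5)[OF _ \<open>y \<sqsubseteq> p\<close> le_trans[OF p(1) lt_le[OF that(1)]]] by blast
      then show ?thesis using that le_trans[OF that(3) p(1)] unfolding D_def by blast
    qed
    show "q \<in> D" if "p \<in> D" "p \<in> \<delta> q" "q \<in> \<delta> x" "q \<noteq> x" for p q
    proof -
      have p: "p \<sqsubseteq> w" "\<And>z. w \<sqsubset> z \<Longrightarrow> z \<sqsubset> x \<Longrightarrow> p \<notin> \<delta> z" using that unfolding D_def by auto
      have "q \<sqsubset> x" using that o(4) by (simp add: tlt_def)
      then have "q \<sqsubseteq> w" using comparable[OF o(4)[OF that(2)] p(1)] p(2) that(2) by blast
      moreover have "q \<notin> \<delta> z" if "w \<sqsubset> z" "z \<sqsubset> x" for z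
        using p(2)[OF that] o(6)[of q z] \<open>p \<in> \<delta> q\<close> by blast
      ultimately show ?thesis using that unfolding D_def by blast
    qed
  qed fact
  then obtain u where u: "u \<in> D" "removable \<delta> x u" by blast
  then have "u \<in> \<delta> x \<inter> dn w" "u \<notin> pop \<delta> x"
    using o(3)[OF o(2), of u x] unfolding D_def Pop_eq[OF assms(1)] by auto
  then show ?thesis using Pop_le by blast
qed

subsection \<open>Upper bound\<close>

lemma orn_iter: "orn \<delta> \<Longrightarrow> orn ((pop ^^ t) \<delta>)"
  by (induction t) (auto intro: orn_Pop)

lemma dn_mono: "u \<sqsubseteq> v \<Longrightarrow> dn u \<subseteq> dn v"
  using le_trans[of _ u v] by auto

lemma card_dn_pos: "v \<in> V \<Longrightarrow> card (dn v) > 0"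
  using le_refl[of v] finite_dn[of v] by (auto simp: card_gt_0_iff)

lemma dn_psubset: assumes "u \<sqsubset> v" shows "dn u \<subset> dn v"
proof -
  have "v \<in> dn v" using le_refl[OF le_V(2)[OF lt_le[OF assms]]] by simp
  moreover have "v \<notin> dn u" using le_lt_trans[OF _ assms, of v] lt_irrefl by auto
  ultimately show ?thesis using dn_mono[OF lt_le[OF assms]] by blast
qed

lemma ex_child_above:
  assumes "p \<sqsubset> w"
  shows "\<exists>c. c \<in> V \<and> c \<noteq> r \<and> par c = w \<and> p \<sqsubseteq> c"
proof -
  let ?D = "{y. p \<sqsubseteq> y \<and> y \<sqsubset> w}"
  have "p \<in> ?D" using assms le_refl[OF le_V(1)[OF lt_le[OF assms]]] by simp
  moreover have "?D \<subseteq> V" using le_V(2)[of p] by blast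
  ultimately obtain c where c: "p \<sqsubseteq> c" "c \<sqsubset> w" "\<forall>y\<in>?D. c \<sqsubseteq> y \<longrightarrow> y = c"
    using maximal_elem[of ?D] by blast
  have cV: "c \<in> V" "c \<noteq> r" "par c \<sqsubseteq> w" using le_V(2)[OF c(1)] par_le[OF c(2)] by auto
  note lt = lt_par[OF cV(1,2)]
  have "par c = w"
  proof (rule ccontr)
    assume "par c \<noteq> w"
    then have "par c \<in> ?D" using le_trans[OF c(1) lt_le[OF lt]] cV(3) by (simp add: tlt_def)
    then show False using c(3) lt unfolding tlt_def by fastforce
  qed
  then show ?thesis using cV c by blast
qed

text \<open>Along the ancestors \<open>x\<close> of \<open>w\<close> the numbers \<open>card (\<delta> x \<inter> dn w)\<close> behave like particles moving
  towards 0 that may only be blocked by the particle directly ahead, so that every ancestor costs a delay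
  of at most one step.\<close>

lemma card_below_bound:
  assumes "orn \<delta>" "w \<sqsubset> x"
  shows "card ((pop ^^ t) \<delta> x \<inter> dn w) = 0 \<or>
    card ((pop ^^ t) \<delta> x \<inter> dn w) + t + 1 + dep x \<le> card (dn w) + dep w"
  using assms(2)
proof (induction t arbitrary: x)
  case 0
  then show ?case using depth_less[OF 0] card_mono[OF finite_dn, of "\<delta> x \<inter> dn w" w] by simp
next
  case (Suc t)
  let ?D = "(pop ^^ t) \<delta>"
  note o = ornD[OF orn_iter[OF assms(1), of t]]
  have fin: "finite (?D x \<inter> dn w)" using finite_dn by simp
  have sub: "(pop ^^ Suc t) \<delta> x \<inter> dn w \<subseteq> ?D x \<inter> dn w" using Pop_le[of ?D x] by auto
  have le: "card ((pop ^^ Suc t) \<delta> x \<inter> dn w) \<le> card (?D x \<inter> dn w)" by (rule card_mono[OF fin sub])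
  show ?case
  proof (cases "card (?D x \<inter> dn w) = 0 \<or> card (?D x \<inter> dn w) + Suc t + 1 + dep x \<le> card (dn w) + dep w")
    case True
    then show ?thesis using le by linarith
  next
    \<comment> \<open>The critical case: the bound at time \<open>t\<close> is attained, so the
      count has to decrease strictly.\<close>
    case False
    then have eq: "card (?D x \<inter> dn w) + t + 1 + dep x = card (dn w) + dep w"
      and ne: "card (?D x \<inter> dn w) \<noteq> 0"
      using Suc.IH[OF Suc.prems] by linarith+
    have "?D x \<inter> dn w \<noteq> {}" using ne by (metis card.empty)
    then obtain p where "p \<in> ?D x" "p \<sqsubseteq> w" by auto
    then have w: "w \<in> ?D x" using o(5) lt_le[OF Suc.prems] by blast
    have "(pop ?D) x \<inter> dn w \<subset> ?D x \<inter> dn w"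
    proof (rule Pop_shrinks_below[OF orn_iter[OF assms(1)] w])
      show "w \<noteq> x" using Suc.prems by (simp add: tlt_def)
      fix z assume z: "w \<sqsubset> z" "z \<sqsubset> x"
      show "?D z \<inter> dn w \<noteq> ?D x \<inter> dn w"
      proof
        \<comment> \<open>A blocking \<open>z\<close> would carry the same positive count, but being
          deeper than \<open>x\<close> it obeys a strictly smaller bound.\<close>
        assume "?D z \<inter> dn w = ?D x \<inter> dn w"
        then show False using Suc.IH[OF z(1)] eq ne depth_less[OF z(2)] by auto
      qed
    qed
    then have "card ((pop ^^ Suc t) \<delta> x \<inter> dn w) < card (?D x \<inter> dn w)"
      using psubset_card_mono[OF fin] by simp
    then show ?thesis using eq by linarith
  qed
qed

text \<open>The time until \<open>w\<close> leaves the ornament of its \<open>i\<close>-th ancestor \<open>x\<close> should be at most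
  \<open>K - 2 * dep w + 1 + i\<close>; with \<open>i = dep w - dep x\<close> this is the inequality below. One step up
  in the tree thus costs two time steps.\<close>

definition cleared :: "nat \<Rightarrow> ('a \<Rightarrow> 'a set) \<Rightarrow> 'a \<Rightarrow> bool" where
  "cleared K \<delta> w \<longleftrightarrow> 2 * dep w \<le> K + 1 \<and>
    (\<forall>x t. w \<sqsubset> x \<longrightarrow> K + 1 \<le> t + dep w + dep x \<longrightarrow> w \<notin> (pop ^^ t) \<delta> x)"

text \<open>A positive count in \<open>card_below_bound\<close> forces
  \<open>t + dep w + dep x \<le> K\<close>; this is where the constant \<open>K + 2\<close> comes
  from.\<close>

lemma small_cleared:
  assumes "orn \<delta>" "w \<in> V" "card (dn w) + 2 * dep w \<le> K + 2"
  shows "cleared K \<delta> w"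
proof -
  have "w \<notin> (pop ^^ t) \<delta> x" if "w \<sqsubset> x" "K + 1 \<le> t + dep w + dep x" for x t
  proof
    assume "w \<in> (pop ^^ t) \<delta> x"
    then have "w \<in> (pop ^^ t) \<delta> x \<inter> dn w" using le_refl assms(2) by simp
    then have "card ((pop ^^ t) \<delta> x \<inter> dn w) > 0" using finite_dn[of w] by (auto simp: card_gt_0_iff)
    then show False using card_below_bound[OF assms(1) that(1), of t] that(2) assms(3) by linarith
  qed
  then show ?thesis unfolding cleared_def using card_dn_pos[OF assms(2)] assms(3) by auto
qed

lemma children_cleared:
  assumes "orn \<delta>" "w \<in> V" "\<exists>c\<in>V. c \<noteq> r \<and> par c = w"
    and child: "\<And>c. c \<in> V \<Longrightarrow> c \<noteq> r \<Longrightarrow> par c = w \<Longrightarrow> cleared K \<delta> c"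
  shows "cleared K \<delta> w"
proof -
  \<comment> \<open>Children are one level deeper, so the first conjunct of \<open>cleared\<close>
    improves by two. It rules out the case \<open>t = 0\<close> below.\<close>
  have dw: "2 * dep w + 2 \<le> K + 1"
    using assms(3) child depth_par unfolding cleared_def by fastforce
  have "w \<notin> (pop ^^ t) \<delta> x" if "w \<sqsubset> x" "K + 1 \<le> t + dep w + dep x" for x t
    using that
  proof (induction t arbitrary: x)
    case 0
    then show ?case using dw depth_less[OF 0(1)] by simp
  next
    case (Suc t)
    let ?D = "(pop ^^ t) \<delta>"
    note o = ornD[OF orn_iter[OF assms(1), of t]]
    show ?case
    proof (cases "w \<in> ?D x")
      case True
      \<comment> \<open>As \<open>dep c = dep w + 1\<close>, the deadline of \<open>w\<close> at
        time \<open>Suc t\<close> is that of its children at time \<open>t\<close>. They have all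
        left, and \<open>w\<close> is the last node to go.\<close>
      have only: "p = w" if p: "p \<in> ?D x" "p \<sqsubseteq> w" for p
      proof (rule ccontr)
        assume "p \<noteq> w"
        then obtain c where c: "c \<in> V" "c \<noteq> r" "par c = w" "p \<sqsubseteq> c"
          using ex_child_above[of p w] p by (auto simp: tlt_def)
        have cw: "c \<sqsubset> w" using lt_par c by blast
        have cx: "c \<sqsubset> x" using lt_le_trans[OF cw lt_le[OF Suc.prems(1)]] .
        have "c \<in> ?D x" using o(5)[OF p(1) c(4) lt_le[OF cx]] .
        moreover have "K + 1 \<le> t + dep c + dep x" using Suc.prems(2) depth_par[OF c(1,2)] c(3) by simp
        ultimately show False using child[OF c(1-3)] cx unfolding cleared_def by blast
      qed
      have "(pop ?D) x \<inter> dn w \<subset> ?D x \<inter> dn w"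
      proof (rule Pop_shrinks_below[OF orn_iter[OF assms(1)] True])
        show "w \<noteq> x" using Suc.prems by (simp add: tlt_def)
        fix z assume z: "w \<sqsubset> z" "z \<sqsubset> x" "w \<in> ?D z"
        then show "?D z \<inter> dn w \<noteq> ?D x \<inter> dn w"
          using Suc.IH[OF z(1)] Suc.prems(2) depth_less[OF z(2)] by simp
      qed
      moreover have "?D x \<inter> dn w \<subseteq> {w}" using only by auto
      ultimately have "(pop ?D) x \<inter> dn w = {}" by blast
      then show ?thesis using le_refl[OF assms(2)] by auto
    next
      case False
      then show ?thesis using Pop_le[of ?D x] by auto
    qed
  qed
  then show ?thesis using dw unfolding cleared_def by auto
qed

text \<open>Induction on the size of the subtree: a node that is neither small nor cleared is a leaf
  or has a child that is not cleared, and the path found for that child is extended by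
  \<open>w\<close>.\<close>

lemma cleared_or_branch:
  assumes "orn \<delta>" "w \<in> V"
  shows "cleared K \<delta> w \<or>
    (\<exists>l\<in>V. dn l = {l} \<and> l \<sqsubseteq> w \<and> (\<forall>v. l \<sqsubseteq> v \<longrightarrow> v \<sqsubseteq> w \<longrightarrow> K + 2 < card (dn v) + 2 * dep v))"
  using assms(2)
proof (induction "card (dn w)" arbitrary: w rule: less_induct)
  case less
  show ?case
  proof (cases "card (dn w) + 2 * dep w \<le> K + 2")
    case True
    then show ?thesis using small_cleared assms(1) less.prems by blast
  next
    case big: False
    show ?thesis
    proof (cases "\<exists>c\<in>V. c \<noteq> r \<and> par c = w")
      case False
      then have no: "\<not> p \<sqsubset> w" for p using ex_child_above[of p w] by blast
      have "x = w" if "x \<sqsubseteq> w" for x using no le_cases[OF that] by blast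
      then have "dn w = {w}" using le_refl[OF less.prems] by auto
      moreover have "v = w" if "w \<sqsubseteq> v" "v \<sqsubseteq> w" for v using le_antisym that by blast
      ultimately show ?thesis using big less.prems le_refl[OF less.prems]
        by (metis not_le)
    next
      case True
      show ?thesis
      proof (cases "\<forall>c\<in>V. c \<noteq> r \<longrightarrow> par c = w \<longrightarrow> cleared K \<delta> c")
        case cl: True
        then show ?thesis using children_cleared[OF assms(1) less.prems True] by blast
      next
        case False
        then obtain c where c: "c \<in> V" "c \<noteq> r" "par c = w" "\<not> cleared K \<delta> c" by blast
        have cw: "c \<sqsubset> w" using lt_par c by blast
        have "card (dn c) < card (dn w)" using psubset_card_mono[OF finite_dn dn_psubset[OF cw]] .
        then obtain l where l: "l \<in> V" "dn l = {l}" "l \<sqsubseteq> c"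
          "\<forall>v. l \<sqsubseteq> v \<longrightarrow> v \<sqsubseteq> c \<longrightarrow> K + 2 < card (dn v) + 2 * dep v"
          using less.hyps[OF _ c(1)] c(4) by blast
        have "K + 2 < card (dn v) + 2 * dep v" if v: "l \<sqsubseteq> v" "v \<sqsubseteq> w" for v
        proof (cases "v \<sqsubseteq> c")
          case False
          then have "c \<sqsubset> v" using comparable[OF v(1) l(3)] by blast
          then have "w \<sqsubseteq> v" using par_le(2) c(3) by blast
          then have "v = w" using le_antisym v(2) by blast
          then show ?thesis using big by simp
        qed (use l v in blast)
        then show ?thesis using l le_trans[OF l(3) lt_le[OF cw]] by blast
      qed
    qed
  qed
qed

section \<open>Reaching the bottom and counting the orbit\<close>

lemma reaches_bottom:
  assumes "orn \<delta>"
    and small: "\<And>l. l \<in> V \<Longrightarrow> dn l = {l} \<Longrightarrow> \<exists>v. l \<sqsubseteq> v \<and> v \<noteq> r \<and> card (dn v) + 2 * dep v \<le> K + 2"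
    and "x \<in> V"
  shows "(pop ^^ K) \<delta> x = {x}"
proof -
  let ?D = "(pop ^^ K) \<delta>"
  note o = ornD[OF orn_iter[OF assms(1), of K]]
  have cut: "y \<notin> ?D (par y)" if y: "y \<in> V" "y \<noteq> r" for y
  proof -
    note ly = lt_par[OF y] and dy = depth_par[OF y]
    consider "cleared K \<delta> y" | l where "l \<in> V" "dn l = {l}" "l \<sqsubseteq> y"
      "\<forall>v. l \<sqsubseteq> v \<longrightarrow> v \<sqsubseteq> y \<longrightarrow> K + 2 < card (dn v) + 2 * dep v"
      using cleared_or_branch[OF assms(1) y(1), of K] by blast
    then show ?thesis
    proof cases
      case 1
      then show ?thesis using ly dy unfolding cleared_def by simp
    next
      case 2
      \<comment> \<open>The small node on the path from \<open>l\<close> to the root must lie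
        strictly above \<open>y\<close>. Since \<open>dep v \<ge> 1\<close>, it bounds
        \<open>card (dn y)\<close> by \<open>K\<close>, and then \<open>card_below_bound\<close>
        alone removes \<open>y\<close> from the ornament of its parent by time
        \<open>K\<close>.\<close>
      obtain v where v: "l \<sqsubseteq> v" "v \<noteq> r" "card (dn v) + 2 * dep v \<le> K + 2" using small 2(1,2) by blast
      have yv: "y \<sqsubset> v" using comparable[OF v(1) 2(3)] 2(4) v(1,3) by force
      have "dep v \<ge> 1" using depth_par[OF le_V(2)[OF v(1)] v(2)] by simp
      then have "card (dn y) \<le> K" using v(3) card_mono[OF finite_dn dn_mono[OF lt_le[OF yv]]] by linarith
      then have "card (?D (par y) \<inter> dn y) = 0"
        using card_below_bound[OF assms(1) ly, of K] dy by linarith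
      then have "?D (par y) \<inter> dn y = {}" using finite_dn by simp
      then show ?thesis using le_refl[OF y(1)] by auto
    qed
  qed
  have "p = x" if "p \<in> ?D x" for p
  proof (rule ccontr)
    assume "p \<noteq> x"
    then have "p \<sqsubset> x" using o(4)[OF that] by (simp add: tlt_def)
    then obtain c where c: "c \<in> V" "c \<noteq> r" "par c = x" "p \<sqsubseteq> c" using ex_child_above by blast
    have "c \<in> ?D x" using o(5)[OF that c(4)] lt_le[OF lt_par[OF c(1,2)]] c(3) by blast
    then show False using cut c by blast
  qed
  then show ?thesis using o(3)[OF assms(3)] by blast
qed

lemma card_orbit_le:
  assumes "orn \<delta>" and bot: "\<And>x. x \<in> V \<Longrightarrow> (pop ^^ K) \<delta> x = {x}"
  shows "card (orbit V par r \<delta>) \<le> K + 1"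
proof -
  let ?B = "(pop ^^ K) \<delta>"
  \<comment> \<open>\<open>o(1)\<close> to \<open>o(6)\<close> concern \<open>?B\<close>,
    \<open>o(7)\<close> to \<open>o(12)\<close> concern \<open>pop ?B\<close>.\<close>
  note o = ornD[OF orn_iter[OF assms(1), of K]] ornD[OF orn_Pop[OF orn_iter[OF assms(1), of K]]]
  have "pop ?B x = ?B x" for x
  proof (cases "x \<in> V")
    case True
    then show ?thesis using bot[OF True] Pop_le[of ?B x] o(9)[OF True] by auto
  next
    case False
    then show ?thesis using o(1,7) by blast
  qed
  then have stable: "pop ?B = ?B" by (rule ext)
  have late: "(pop ^^ (K + j)) \<delta> = ?B" for j by (induction j) (simp_all add: stable)
  have "(pop ^^ k) \<delta> \<in> (\<lambda>t. (pop ^^ t) \<delta>) ` {..K}" for k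
  proof (cases "k \<le> K")
    case False
    then show ?thesis using late[of "k - K"] by auto
  qed simp
  then have "orbit V par r \<delta> \<subseteq> (\<lambda>t. (pop ^^ t) \<delta>) ` {..K}" unfolding orbit_def by blast
  then have "card (orbit V par r \<delta>) \<le> card {..K}" by (rule surj_card_le[OF finite_atMost])
  then show ?thesis by simp
qed

subsection \<open>Lower bound\<close>

text \<open>The list \<open>fs @ cs\<close> is the order in which the ornament of the root is going to lose its nodes:
  \<open>cs\<close> is a path ending in \<open>w\<close>, and every node \<open>bs ! p\<close> of this path whose ornament is
  nontrivial at the start comes with one extra node \<open>fs ! p\<close> below it.\<close>

definition scaffold :: "'a \<Rightarrow> 'a list \<Rightarrow> 'a list \<Rightarrow> 'a list \<Rightarrow> bool" where
  "scaffold w fs cs bs \<longleftrightarrow>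
     cs \<noteq> [] \<and> w \<in> set cs \<and> sorted_wrt (\<sqsubset>) cs \<and>
     set bs \<subseteq> set cs \<and> sorted_wrt (\<lambda>x y. y \<sqsubset> x) bs \<and>
     length fs = length bs \<and> (\<forall>p<length bs. fs ! p \<sqsubset> bs ! p) \<and>
     sorted_wrt (\<lambda>x y. \<not> y \<sqsubseteq> x) (fs @ cs) \<and>
     (\<forall>x\<in>set (fs @ cs). x \<sqsubseteq> w \<and> (\<forall>z. x \<sqsubseteq> z \<longrightarrow> z \<sqsubseteq> w \<longrightarrow> z \<in> set (fs @ cs)))"

lemma scaffold_leaf: "w \<in> V \<Longrightarrow> scaffold w [] [w] []"
  unfolding scaffold_def using le_refl le_antisym by auto

lemma scaffold_grow_aux:
  assumes "scaffold w fs cs bs" "w \<noteq> r"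
  shows "x \<in> set (fs @ cs) \<Longrightarrow> x \<sqsubset> par w"
    and "x \<in> set (fs @ cs) \<Longrightarrow> x \<sqsubseteq> z \<Longrightarrow> z \<sqsubseteq> par w \<Longrightarrow> z = par w \<or> z \<in> set (fs @ cs)"
    and "sorted_wrt (\<sqsubset>) (cs @ [par w])"
    and "sorted_wrt (\<lambda>x y. \<not> y \<sqsubseteq> x) (fs @ cs @ [par w])"
    and "par w \<in> V"
proof -
  have S: "x \<sqsubseteq> w" "x \<sqsubseteq> z \<Longrightarrow> z \<sqsubseteq> w \<Longrightarrow> z \<in> set (fs @ cs)" if "x \<in> set (fs @ cs)" for x z
    using assms that unfolding scaffold_def by blast+
  have "w \<in> set (fs @ cs)" using assms unfolding scaffold_def by simp
  then have wV: "w \<in> V" using S le_V(2) by blast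
  have lt: "w \<sqsubset> par w" using lt_par[OF wV assms(2)] .
  show "par w \<in> V" using par_in_V[OF wV assms(2)] .
  show a: "x \<sqsubset> par w" if "x \<in> set (fs @ cs)" for x using le_lt_trans[OF S(1)[OF that] lt] .
  show "z = par w \<or> z \<in> set (fs @ cs)" if x: "x \<in> set (fs @ cs)" "x \<sqsubseteq> z" "z \<sqsubseteq> par w"
  proof (cases "z \<sqsubseteq> w")
    case False
    then have "w \<sqsubset> z" using comparable[OF x(2) S(1)[OF x(1)]] by blast
    then show ?thesis using par_le(2) x(3) le_antisym by blast
  qed (use S(2) x in blast)
  have c: "sorted_wrt (\<sqsubset>) cs" "sorted_wrt (\<lambda>x y. \<not> y \<sqsubseteq> x) (fs @ cs)"
    using assms unfolding scaffold_def by blast+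
  show "sorted_wrt (\<sqsubset>) (cs @ [par w])" using c(1) a by (simp add: sorted_wrt_append)
  have "\<not> par w \<sqsubseteq> x" if "x \<in> set (fs @ cs)" for x
    using a[OF that] le_lt_trans lt_irrefl by blast
  then show "sorted_wrt (\<lambda>x y. \<not> y \<sqsubseteq> x) (fs @ cs @ [par w])"
    using c(2) by (auto simp: sorted_wrt_append)
qed

text \<open>The step up for the case that everything below the parent has been collected: the parent
  joins the path with a trivial ornament.\<close>

lemma scaffold_grow1:
  assumes "scaffold w fs cs bs" "w \<noteq> r"
  shows "scaffold (par w) fs (cs @ [par w]) bs"
proof -
  note a = scaffold_grow_aux[OF assms]
  have "\<forall>x\<in>set (fs @ cs @ [par w]). x \<sqsubseteq> par w \<and>
      (\<forall>z. x \<sqsubseteq> z \<longrightarrow> z \<sqsubseteq> par w \<longrightarrow> z \<in> set (fs @ cs @ [par w]))"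
  proof
    fix x assume "x \<in> set (fs @ cs @ [par w])"
    then consider "x \<in> set (fs @ cs)" | "x = par w" by auto
    then show "x \<sqsubseteq> par w \<and> (\<forall>z. x \<sqsubseteq> z \<longrightarrow> z \<sqsubseteq> par w \<longrightarrow> z \<in> set (fs @ cs @ [par w]))"
    proof cases
      case 1
      then show ?thesis using lt_le[OF a(1)[OF 1]] a(2)[OF 1] by auto
    next
      case 2
      then show ?thesis using le_refl[OF a(5)] le_antisym[of "par w"] by simp blast
    qed
  qed
  moreover have "set bs \<subseteq> set cs" "sorted_wrt (\<lambda>x y. y \<sqsubset> x) bs"
     "length fs = length bs" "\<forall>p<length bs. fs ! p \<sqsubset> bs ! p"
    using assms(1) unfolding scaffold_def by blast+
  moreover from this(1) have "set bs \<subseteq> set (cs @ [par w])" by auto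
  ultimately show ?thesis using a(3,4) unfolding scaffold_def by simp
qed

text \<open>Here the parent becomes the owner of a nontrivial ornament and brings one extra node
  \<open>f\<close>. Both go to the front, since \<open>f\<close> is to be lost first and
  \<open>bs\<close> runs from top to bottom. The condition on \<open>par f\<close> keeps the
  collection closed upwards.\<close>

lemma scaffold_grow2:
  assumes "scaffold w fs cs bs" "w \<noteq> r"
    and f: "f \<sqsubset> par w" "f \<notin> set (fs @ cs)" "par f = par w \<or> par f \<in> set (fs @ cs)"
  shows "scaffold (par w) (f # fs) (cs @ [par w]) (par w # bs)"
proof -
  note a = scaffold_grow_aux[OF assms(1,2)]
  have S: "x \<sqsubseteq> w" "x \<sqsubseteq> z \<Longrightarrow> z \<sqsubseteq> w \<Longrightarrow> z \<in> set (fs @ cs)" if "x \<in> set (fs @ cs)" for x z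
    using assms that unfolding scaffold_def by blast+
  have bs: "set bs \<subseteq> set cs" "sorted_wrt (\<lambda>x y. y \<sqsubset> x) bs"
     "length fs = length bs" "\<forall>p<length bs. fs ! p \<sqsubset> bs ! p"
    using assms(1) unfolding scaffold_def by blast+
  have fne: "\<not> x \<sqsubseteq> f" if "x \<in> set (fs @ cs @ [par w])" for x
  proof
    assume xf: "x \<sqsubseteq> f"
    from that consider "x \<in> set (fs @ cs)" | "x = par w" by auto
    then show False
    proof cases
      case 1
      then show ?thesis using a(2)[OF 1 xf lt_le[OF f(1)]] f(1,2) lt_irrefl by blast
    next
      case 2
      then show ?thesis using xf le_lt_trans[OF _ f(1), of x] lt_irrefl by blast
    qed
  qed
  have up: "\<forall>x\<in>set (f # fs @ cs @ [par w]). x \<sqsubseteq> par w \<and>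
      (\<forall>z. x \<sqsubseteq> z \<longrightarrow> z \<sqsubseteq> par w \<longrightarrow> z \<in> set (f # fs @ cs @ [par w]))"
  proof
    fix x assume "x \<in> set (f # fs @ cs @ [par w])"
    then consider "x \<in> set (fs @ cs)" | "x = par w" | "x = f" by auto
    then show "x \<sqsubseteq> par w \<and> (\<forall>z. x \<sqsubseteq> z \<longrightarrow> z \<sqsubseteq> par w \<longrightarrow> z \<in> set (f # fs @ cs @ [par w]))"
    proof cases
      case 1
      then show ?thesis using lt_le[OF a(1)[OF 1]] a(2)[OF 1] by auto
    next
      case 2
      then show ?thesis using le_refl[OF a(5)] le_antisym[of "par w"] by simp blast
    next
      case 3
      have "z \<in> set (f # fs @ cs @ [par w])" if z: "f \<sqsubseteq> z" "z \<sqsubseteq> par w" for z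
      proof (cases "z = f")
        case False
        then have "par f \<sqsubseteq> z" using par_le(2)[of f z] z(1) by (simp add: tlt_def)
        then show ?thesis using f(3) a(2)[of "par f" z] z(2) le_antisym by auto
      qed simp
      then show ?thesis using 3 lt_le[OF f(1)] by blast
    qed
  qed
  have b: "\<forall>x\<in>set bs. x \<sqsubset> par w" using bs(1) a(1) by auto
  have p: "\<forall>p<length (par w # bs). (f # fs) ! p \<sqsubset> (par w # bs) ! p"
    using bs(4) f(1) by (auto simp: nth_Cons split: nat.split)
  show ?thesis unfolding scaffold_def
    using a(3,4) subset_insertI2[OF bs(1), of "par w"] bs(2,3) b p fne up by simp
qed

end

section \<open>An orbit in which the root loses one node per step\<close>

locale scaffolded = rtree +
  fixes w :: 'a and fs cs bs :: "'a list"
  assumes scaffold: "scaffold w fs cs bs" and w_not_root: "w \<noteq> r" and par_w: "par w = r"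
begin

definition xs where "xs = fs @ cs"
text \<open>The owners of the nontrivial ornaments, from the root downwards. Because of the shift by
  one against \<open>bs\<close>, the extra node \<open>xs ! p\<close> lies below
  \<open>act ! Suc p\<close>.\<close>

definition act where "act = r # bs"

text \<open>The ornamentation after \<open>t\<close> steps: the \<open>p\<close>-th nontrivial ornament is \<open>p\<close> steps ahead
  of the root, so it has already lost the first \<open>t + p\<close> entries of \<open>xs\<close>.\<close>

definition D :: "nat \<Rightarrow> 'a \<Rightarrow> 'a set" where
  "D t v = (if v \<in> V then insert v {x. \<exists>p i. p < length act \<and> act ! p = v \<and>
      t + p \<le> i \<and> i < length xs \<and> x = xs ! i \<and> x \<sqsubset> v} else {})"

lemma xs_below: "x \<in> set xs \<Longrightarrow> x \<sqsubset> r"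
  using scaffold_grow_aux(1)[OF scaffold w_not_root] par_w unfolding xs_def by simp

lemma xs_nth_below: "i < length xs \<Longrightarrow> xs ! i \<sqsubset> r"
  using xs_below nth_mem by blast

lemma xs_up: assumes "x \<in> set xs" "x \<sqsubseteq> z" "z \<noteq> r" shows "z \<in> set xs"
  using scaffold_grow_aux(2)[OF scaffold w_not_root, of x z] par_w assms le_root[OF le_V(2)[OF assms(2)]]
  unfolding xs_def by simp

lemma xs_index: assumes "i < length xs" "j < length xs" "xs ! i \<sqsubseteq> xs ! j" shows "i \<le> j"
proof (rule ccontr)
  assume "\<not> i \<le> j"
  moreover have "sorted_wrt (\<lambda>x y. \<not> y \<sqsubseteq> x) xs" using scaffold unfolding scaffold_def xs_def by blast
  ultimately show False using assms sorted_wrt_nth_less[of _ xs j i] by auto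
qed

lemma xs_inj: assumes "i < length xs" "j < length xs" "xs ! i = xs ! j" shows "i = j"
  using xs_index[of i j] xs_index[of j i] assms le_refl[of "xs ! j"]
    le_V(1)[OF lt_le[OF xs_nth_below[of j]]] by fastforce

lemma bs_in: "x \<in> set bs \<Longrightarrow> x \<in> set cs" and cs_in: "x \<in> set cs \<Longrightarrow> x \<in> set xs"
  using scaffold unfolding scaffold_def xs_def by auto

lemma act_V: "p < length act \<Longrightarrow> act ! p \<in> V"
  unfolding act_def using bs_in cs_in xs_below root_in_V lt_le le_V(1)
  by (cases p) (auto, meson nth_mem)

lemma act_less: assumes "p < p'" "p' < length act" shows "act ! p' \<sqsubset> act ! p"
proof -
  have "sorted_wrt (\<lambda>x y. y \<sqsubset> x) act"
    using scaffold bs_in cs_in xs_below unfolding scaffold_def act_def by auto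
  then show ?thesis using sorted_wrt_nth_less[OF _ assms] by blast
qed

lemma act_index: assumes "p < length act" "p' < length act" "act ! p' \<sqsubset> act ! p" shows "p < p'"
  using assms act_less[of p' p] le_lt_trans[OF lt_le, of "act ! p'" "act ! p" "act ! p'"] lt_irrefl
  by (metis linorder_neqE_nat)

lemma act_inj: assumes "p < length act" "p' < length act" "act ! p' = act ! p" shows "p = p'"
  using assms act_less[of p' p] act_less[of p p'] lt_irrefl by (metis linorder_neqE_nat)

lemma fs_below: assumes "p < length fs" shows "Suc p < length act" "xs ! p \<sqsubset> act ! Suc p"
  using scaffold assms unfolding scaffold_def act_def xs_def by (auto simp: nth_append)

lemma cs_nth: assumes "length fs \<le> i" "i < length xs" shows "xs ! i \<in> set cs"
  using assms unfolding xs_def by (simp add: nth_append)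

lemma cs_total: assumes "x \<in> set cs" "y \<in> set cs" shows "x \<sqsubset> y \<or> y \<sqsubseteq> x"
proof -
  obtain i j where ij: "i < length cs" "x = cs ! i" "j < length cs" "y = cs ! j"
    using assms by (metis in_set_conv_nth)
  have s: "sorted_wrt (\<sqsubset>) cs" using scaffold unfolding scaffold_def by blast
  have "y \<in> V" using assms(2) cs_in xs_below lt_le le_V(1) by blast
  then show ?thesis using ij sorted_wrt_nth_less[OF s, of i j] sorted_wrt_nth_less[OF s, of j i]
      lt_le le_refl by (metis linorder_neqE_nat)
qed

text \<open>If \<open>xs ! j\<close> lies in the \<open>p\<close>-th ornament but is not protected by the next one, then it has
  to wait for all earlier entries, since they lie below it.\<close>

lemma xs_less:
  assumes "p < length act" "p \<le> i" "i < j" "j < length xs"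
    and "\<not> (Suc p < length act \<and> xs ! j \<sqsubset> act ! Suc p)"
  shows "xs ! i \<sqsubset> xs ! j"
proof -
  \<comment> \<open>The owners descend, so all extra nodes from index \<open>p\<close> on lie below
    \<open>act ! Suc p\<close>. Hence the unprotected \<open>xs ! j\<close> belongs to the path
    \<open>cs\<close>.\<close>
  have f: "Suc p < length act \<and> xs ! k \<sqsubset> act ! Suc p" if "p \<le> k" "k < length fs" for k
  proof (cases "k = p")
    case False
    then have "p < k" using that by simp
    note k = fs_below[OF that(2)]
    have "act ! Suc k \<sqsubset> act ! Suc p" using act_less[of "Suc p" "Suc k"] \<open>p < k\<close> k(1) by simp
    then show ?thesis using \<open>p < k\<close> k(1) lt_le_trans[OF k(2) lt_le] by simp
  qed (use fs_below that in auto)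
  have j: "length fs \<le> j" using f[of j] assms by force
  then have jc: "xs ! j \<in> set cs" using cs_nth assms by blast
  show ?thesis
  proof (cases "i < length fs")
    case True
    note fi = f[OF assms(2) True]
    then have "act ! Suc p \<in> set cs" using bs_in unfolding act_def by simp
    then have "act ! Suc p \<sqsubseteq> xs ! j" using cs_total[OF jc] assms(5) fi by blast
    then show ?thesis using lt_le_trans fi by blast
  next
    case False
    then have "xs ! i \<in> set cs" using cs_nth assms by auto
    then show ?thesis using cs_total[OF _ jc] xs_index[of j i] assms by fastforce
  qed
qed

lemma D_act: assumes "p < length act"
  shows "x \<in> D t (act ! p) \<longleftrightarrow> x = act ! p \<or> (\<exists>i. t + p \<le> i \<and> i < length xs \<and> x = xs ! i \<and> x \<sqsubset> act ! p)"
  unfolding D_def using act_V[OF assms] act_inj[OF assms] assms by auto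

lemma D_other: assumes "v \<notin> set act" "v \<in> V" shows "D t v = {v}"
  using assms unfolding D_def by (auto simp: in_set_conv_nth)

lemma D_cases: assumes "x \<in> D t v" "x \<noteq> v"
  obtains p i where "p < length act" "v = act ! p" "t + p \<le> i" "i < length xs" "x = xs ! i" "x \<sqsubset> v"
  using assms unfolding D_def by (auto split: if_splits)

lemma D_intro: assumes "p < length act" "t + p \<le> i" "i < length xs" "xs ! i \<sqsubset> act ! p"
  shows "xs ! i \<in> D t (act ! p)"
  using D_act[OF assms(1)] assms(2-) by blast

lemma D_self: "v \<in> V \<Longrightarrow> v \<in> D t v" unfolding D_def by simp

lemma orn_D: "orn (D t)"
  unfolding orn_iff
proof (intro conjI allI impI ballI)
  fix v assume v: "v \<in> V"
  show "v \<in> D t v" using v by (rule D_self)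
  have below: "x \<sqsubseteq> v" if "x \<in> D t v" for x
    using D_cases[OF that] lt_le le_refl[OF v] by metis
  then show "D t v \<subseteq> dn v" using dn_iff by blast
  show "z \<in> D t v" if x: "x \<in> D t v" "x \<sqsubseteq> z" "z \<sqsubseteq> v" for x z
  proof (cases "x = v \<or> z = v")
    case True
    then show ?thesis using x le_antisym v D_self by metis
  next
    case False
    then have zv: "z \<sqsubset> v" using x(3) by (simp add: tlt_def)
    have "x \<noteq> v" using False by simp
    from x(1) this obtain p i where p: "p < length act" "v = act ! p" "t + p \<le> i" "i < length xs" "x = xs ! i"
      by (rule D_cases)
    have "z \<noteq> r" using zv par_le(1) by blast
    then have "z \<in> set xs" using xs_up[of x z] x(2) p by simp
    then obtain j where j: "j < length xs" "z = xs ! j" by (metis in_set_conv_nth)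
    \<comment> \<open>Going up never decreases the index, so \<open>z\<close> is lost no earlier
      than \<open>x\<close>.\<close>
    have "i \<le> j" using xs_index[of i j] p j x(2) by simp
    then show ?thesis using D_intro[OF p(1), of t j] p j zv by simp
  qed
  show "D t u \<subseteq> D t v" if u: "u \<in> D t v" for u
  proof (cases "u = v")
    case False
    from u this obtain p i where p: "p < length act" "v = act ! p" "t + p \<le> i" "i < length xs" "u = xs ! i" "u \<sqsubset> v"
      by (rule D_cases)
    show ?thesis
    proof
      fix y assume y: "y \<in> D t u"
      show "y \<in> D t v"
      proof (cases "y = u")
        case False
        from y this obtain q j where q: "q < length act" "u = act ! q" "t + q \<le> j" "j < length xs" "y = xs ! j" "y \<sqsubset> u"
          by (rule D_cases)
        \<comment> \<open>An owner further down has a larger position and is further ahead, so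
          whatever remains in its ornament also remains in that of \<open>v\<close>.\<close>
        have "p < q" using act_index[of p q] p q by simp
        then show ?thesis using D_intro[OF p(1), of t j] p q lt_le_trans[OF q(6) lt_le[OF p(6)]] by simp
      qed (use u in simp)
    qed
  qed simp
next
  fix v assume "v \<notin> V"
  then show "D t v = {}" unfolding D_def by simp
qed

text \<open>Other nodes in the ornament of the front entry would have index at least
  \<open>t + q\<close> for a position \<open>q > p\<close>, whereas nodes below the front entry have
  index at most \<open>t + p\<close>.\<close>

lemma D_front:
  assumes "p < length act" "t + p < length xs" "xs ! (t + p) \<sqsubset> act ! p"
  shows "D t (xs ! (t + p)) = {xs ! (t + p)}"
proof -
  let ?u = "xs ! (t + p)"
  have "y = ?u" if y: "y \<in> D t ?u" for y
  proof (rule ccontr)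
    assume ne: "y \<noteq> ?u"
    from y ne obtain q j where q: "q < length act" "?u = act ! q" "t + q \<le> j" "j < length xs" "y = xs ! j" "y \<sqsubset> ?u"
      by (rule D_cases)
    have "p < q" using act_index[of p q] assms q by simp
    moreover have "j \<le> t + p" using xs_index[of j "t + p"] q lt_le assms(2) by simp
    ultimately show False using q by linarith
  qed
  moreover have "?u \<in> V" using le_V(1)[OF lt_le[OF assms(3)]] .
  ultimately show ?thesis using D_self[of ?u t] by blast
qed

text \<open>Only the front entry of each ornament can go. A later entry either lies in the next
  ornament, against the last clause of \<open>removable\<close>, or lies above the front entry and
  would need it in its own ornament, which is already past that index.\<close>

lemma removable_D:
  "removable (D t) v u \<longleftrightarrow>
    (\<exists>p. p < length act \<and> v = act ! p \<and> t + p < length xs \<and> u = xs ! (t + p) \<and> u \<sqsubset> v)" (is "?L \<longleftrightarrow> ?R")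
proof
  assume ?R
  then obtain p where p: "p < length act" "v = act ! p" "t + p < length xs" "u = xs ! (t + p)" "u \<sqsubset> v" by blast
  have u: "u \<in> D t v" using D_intro[of p t "t + p"] p by simp
  have "u \<noteq> v" using p(5) lt_irrefl by blast
  have "y = u" if y: "y \<sqsubseteq> u" "y \<in> D t v" for y
  proof -
    have "y \<noteq> v" using y(1) p(5) le_lt_trans lt_irrefl by blast
    then obtain i where i: "t + p \<le> i" "i < length xs" "y = xs ! i"
      using D_act[OF p(1), of y t] p(2) y(2) by blast
    then have "i \<le> t + p" using xs_index[of i "t + p"] p y(1) by simp
    then show ?thesis using i p by simp
  qed
  moreover have "u \<sqsubseteq> u" using le_refl le_V(1) lt_le p(5) by blast
  ultimately have dn: "dn u \<inter> D t v = D t u" using u D_front[OF p(1,3)] p by auto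
  have "u \<notin> D t z" if z: "u \<sqsubset> z" "z \<sqsubset> v" for z
  proof
    assume uz: "u \<in> D t z"
    have ne: "u \<noteq> z" using z(1) lt_irrefl by blast
    from uz ne obtain q j where q: "q < length act" "z = act ! q" "t + q \<le> j" "j < length xs" "u = xs ! j"
      by (rule D_cases)
    have "j = t + p" using xs_inj[of j "t + p"] q p by simp
    moreover have "p < q" using act_index[of p q] p q z by simp
    ultimately show False using q by simp
  qed
  then show ?L using u \<open>u \<noteq> v\<close> dn unfolding removable_def by blast
next
  assume L: ?L
  then have u: "u \<in> D t v" "u \<noteq> v" "dn u \<inter> D t v = D t u" "\<And>z. u \<sqsubset> z \<Longrightarrow> z \<sqsubset> v \<Longrightarrow> u \<notin> D t z"
    unfolding removable_def by blast+
  from u(1,2) obtain p j where p: "p < length act" "v = act ! p" "t + p \<le> j" "j < length xs" "u = xs ! j" "u \<sqsubset> v"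
    by (rule D_cases)
  have "j = t + p"
  proof (rule ccontr)
    assume "j \<noteq> t + p"
    then have j: "t + p < j" using p by simp
    show False
    proof (cases "Suc p < length act \<and> u \<sqsubset> act ! Suc p")
      case True
      then have "u \<in> D t (act ! Suc p)" using D_intro[of "Suc p" t j] j p by simp
      moreover have "act ! Suc p \<sqsubset> v" using act_less[of p "Suc p"] True p by simp
      ultimately show ?thesis using u(4) True by blast
    next
      case False
      let ?x = "xs ! (t + p)"
      have xu: "?x \<sqsubset> u" using xs_less[of p "t + p" j] False j p by simp
      then have "?x \<in> D t v"
        using D_intro[of p t "t + p"] lt_le_trans[OF _ lt_le[OF p(6)]] j p by simp
      then have x: "?x \<in> D t u" using u(3) lt_le[OF xu] dn_iff by blast
      have ne: "?x \<noteq> u" using xu lt_irrefl by blast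
      from x ne obtain q i where q: "q < length act" "u = act ! q" "t + q \<le> i" "i < length xs" "?x = xs ! i"
        by (rule D_cases)
      have "i = t + p" using xs_inj[of i "t + p"] q j p by simp
      moreover have "p < q" using act_index[of p q] p q by simp
      ultimately show False using q by simp
    qed
  qed
  then show ?R using p by blast
qed

lemma Pop_D: "pop (D t) = D (Suc t)"
proof (rule ext)
  fix v
  have eq: "pop (D t) v = D t v - (\<Union>u\<in>{u. removable (D t) v u}. D t u)" using Pop_eq[OF orn_D] by simp
  consider "v \<notin> V" | "v \<in> V" "v \<notin> set act" | p where "p < length act" "v = act ! p"
    by (metis in_set_conv_nth)
  then show "pop (D t) v = D (Suc t) v"
  proof cases
    case 1
    then show ?thesis using eq by (simp add: D_def)
  next
    case 2
    then have "\<not> removable (D t) v u" for u using removable_D nth_mem by metis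
    then show ?thesis using eq D_other[OF 2(2,1)] by simp
  next
    case 3
    have rem: "(\<Union>u\<in>{u. removable (D t) v u}. D t u) =
      (if t + p < length xs \<and> xs ! (t + p) \<sqsubset> v then {xs ! (t + p)} else {})"
    proof -
      have "removable (D t) v u \<longleftrightarrow> t + p < length xs \<and> u = xs ! (t + p) \<and> u \<sqsubset> v" for u
        using removable_D[of t v u] 3 act_inj[OF 3(1)] by metis
      then show ?thesis using D_front[OF 3(1), of t] 3(2) by auto
    qed
    show ?thesis
    proof (rule set_eqI)
      fix x
      show "x \<in> pop (D t) v \<longleftrightarrow> x \<in> D (Suc t) v"
      proof
        assume x: "x \<in> pop (D t) v"
        then consider "x = v" | i where "t + p \<le> i" "i < length xs" "x = xs ! i" "x \<sqsubset> v"
          using D_act[OF 3(1), of x t] eq 3(2) by blast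
        then show "x \<in> D (Suc t) v"
        proof cases
          case 2
          have "i \<noteq> t + p" using x eq rem 2 by auto
          then show ?thesis using D_intro[OF 3(1), of "Suc t" i] 2 3 by simp
        qed (use D_self act_V 3 in blast)
      next
        assume "x \<in> D (Suc t) v"
        then consider "x = v" | i where "Suc t + p \<le> i" "i < length xs" "x = xs ! i" "x \<sqsubset> v"
          using D_act[OF 3(1), of x "Suc t"] 3(2) by blast
        then show "x \<in> pop (D t) v"
        proof cases
          case 1
          then show ?thesis using eq rem D_self act_V[OF 3(1)] 3(2) lt_irrefl by auto
        next
          case 2
          have "x \<in> D t v" using D_intro[OF 3(1), of t i] 2 3 by simp
          moreover have "x \<noteq> xs ! (t + p)" if "t + p < length xs" using xs_inj[of i "t + p"] 2 that by auto
          ultimately show ?thesis using eq rem by auto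
        qed
      qed
    qed
  qed
qed

lemma Pop_iter_D: "(pop ^^ t) (D 0) = D t"
  by (induction t) (simp_all add: Pop_D)

lemma D_inj: "inj_on D {..length xs}"
proof -
  have *: "D s \<noteq> D t" if "s < t" "t \<le> length xs" for s t
  proof -
    \<comment> \<open>The root has position 0, and its ornament tells the times apart.\<close>
    have "xs ! s \<in> D s (act ! 0)" using D_intro[of 0 s s] that xs_nth_below[of s] by (simp add: act_def)
    moreover have "xs ! s \<notin> D t (act ! 0)"
      using D_act[of 0 "xs ! s" t] that xs_nth_below[of s] xs_inj[of s] lt_irrefl[of r] by (fastforce simp: act_def)
    ultimately show ?thesis by metis
  qed
  show ?thesis
  proof (rule inj_onI)
    fix s t assume "s \<in> {..length xs}" "t \<in> {..length xs}" "D s = D t"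
    then show "s = t" using *[of s t] *[of t s] by (metis atMost_iff linorder_neqE_nat)
  qed
qed

end

section \<open>From scaffolds to long orbits\<close>

context rtree
begin

lemma finite_Orn: "finite (Orn V par r)"
proof (rule finite_subset)
  show "Orn V par r \<subseteq> {\<delta>. \<forall>v. (v \<in> V \<longrightarrow> \<delta> v \<in> Pow V) \<and> (v \<notin> V \<longrightarrow> \<delta> v = {})}"
    unfolding Orn_def using orn_V by blast
  show "finite {\<delta>. \<forall>v. (v \<in> V \<longrightarrow> \<delta> v \<in> Pow V) \<and> (v \<notin> V \<longrightarrow> \<delta> v = {})}"
    by (rule finite_set_of_finite_funs) (simp_all add: finite_V)
qed

lemma scaffold_orbit:
  assumes "scaffold w fs cs bs" "w \<noteq> r" "par w = r"
  shows "\<exists>\<delta>. orn \<delta> \<and> card (orbit V par r \<delta>) \<ge> length (fs @ cs) + 1"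
proof -
  interpret scaffolded V par r w fs cs bs by unfold_locales (fact assms)+
  have "orbit V par r (D 0) \<subseteq> Orn V par r"
    unfolding orbit_def Orn_def using orn_iter[OF orn_D] by blast
  then have fin: "finite (orbit V par r (D 0))" using finite_Orn finite_subset by blast
  have "D ` {..length xs} \<subseteq> orbit V par r (D 0)"
    unfolding orbit_def using Pop_iter_D by (auto intro: sym)
  then have "card (D ` {..length xs}) \<le> card (orbit V par r (D 0))" by (rule card_mono[OF fin])
  then show ?thesis using card_image[OF D_inj] orn_D by (auto simp: xs_def)
qed

text \<open>A step up lowers \<open>2 * dep w\<close> by two. Either two entries are added in
  exchange, or everything below \<open>w\<close> has been collected and \<open>big\<close> gives the
  bound directly.\<close>

lemma scaffold_exists:
  assumes "l \<in> V" "dn l = {l}"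
    and big: "\<And>v. l \<sqsubseteq> v \<Longrightarrow> v \<noteq> r \<Longrightarrow> m \<le> card (dn v) + 2 * dep v"
    and "l \<sqsubseteq> w" "w \<noteq> r"
  shows "\<exists>fs cs bs. scaffold w fs cs bs \<and> m \<le> length (fs @ cs) + 2 * dep w"
  using assms(4,5)
proof (induction "card (dn w)" arbitrary: w rule: less_induct)
  case less
  show ?case
  proof (cases "w = l")
    case True
    then have "scaffold w [] [l] [] \<and> m \<le> length ([] @ [l]) + 2 * dep w"
      using scaffold_leaf[OF assms(1)] big[OF less.prems] assms(2) by simp
    then show ?thesis by blast
  next
    case False
    then have "l \<sqsubset> w" using less.prems by (simp add: tlt_def)
    then obtain c where c: "c \<in> V" "c \<noteq> r" "par c = w" "l \<sqsubseteq> c" using ex_child_above by blast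
    have cw: "c \<sqsubset> w" using lt_par c by blast
    have "card (dn c) < card (dn w)" using psubset_card_mono[OF finite_dn dn_psubset[OF cw]] .
    then obtain fs cs bs where s: "scaffold c fs cs bs" "m \<le> length (fs @ cs) + 2 * dep c"
      using less.hyps[OF _ c(4,2)] by blast
    have dc: "dep c = Suc (dep w)" using depth_par[OF c(1,2)] c(3) by simp
    let ?F = "dn w - set (fs @ cs @ [w])"
    show ?thesis
    proof (cases "?F = {}")
      case True
      then have "card (dn w) \<le> card (set (fs @ cs @ [w]))" by (intro card_mono) auto
      also have "\<dots> \<le> length (fs @ cs @ [w])" by (rule card_length)
      finally have "m \<le> length (fs @ cs @ [w]) + 2 * dep w" using big[OF less.prems] by linarith
      then show ?thesis using scaffold_grow1[OF s(1) c(2)] c(3) by blast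
    next
      case False
      moreover have "?F \<subseteq> V" using le_V(1)[of _ w] dn_iff by blast
      \<comment> \<open>By maximality the parent of \<open>f\<close> is \<open>w\<close> itself or
        already collected.\<close>
      ultimately obtain f where f: "f \<in> ?F" "\<forall>y\<in>?F. f \<sqsubseteq> y \<longrightarrow> y = f"
        using maximal_elem[of ?F] by blast
      have fw: "f \<sqsubset> w" using f(1) by (auto simp: tlt_def)
      have fV: "f \<in> V" "f \<noteq> r" using le_V(1)[OF lt_le[OF fw]] par_le(1)[OF fw] by auto
      have "par f \<notin> ?F"
        using f(2) lt_par[OF fV] unfolding tlt_def by fastforce
      then have "par f = par c \<or> par f \<in> set (fs @ cs)" using par_le(2)[OF fw] c(3) by auto
      then have "scaffold w (f # fs) (cs @ [w]) (w # bs)"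
        using scaffold_grow2[OF s(1) c(2), of f] c(3) f(1) fw by simp
      moreover have "m \<le> length ((f # fs) @ (cs @ [w])) + 2 * dep w" using s(2) dc by simp
      ultimately show ?thesis by blast
    qed
  qed
qed

lemma long_orbit:
  assumes "l \<in> V" "dn l = {l}" "l \<noteq> r"
    and big: "\<And>v. l \<sqsubseteq> v \<Longrightarrow> v \<noteq> r \<Longrightarrow> m < card (dn v) + 2 * dep v"
  shows "\<exists>\<delta>. orn \<delta> \<and> m \<le> card (orbit V par r \<delta>)"
proof -
  have "l \<sqsubset> r" using le_root[OF assms(1)] assms(3) by (simp add: tlt_def)
  then obtain w where w: "w \<in> V" "w \<noteq> r" "par w = r" "l \<sqsubseteq> w" using ex_child_above by blast
  obtain fs cs bs where s: "scaffold w fs cs bs" "Suc m \<le> length (fs @ cs) + 2 * dep w"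
    using scaffold_exists[OF assms(1,2) _ w(4,2), of "Suc m"] big by (metis Suc_leI)
  \<comment> \<open>The climb stops at a child of the root, whose depth contributes two to the bound
    \<open>Suc m\<close>; the starting ornamentation makes up for the remaining one.\<close>
  have "dep w = 1" using depth_par[OF w(1,2)] w(3) depth_root by simp
  then have "m \<le> length (fs @ cs) + 1" using s(2) by simp
  then show ?thesis using scaffold_orbit[OF s(1) w(2,3)] le_trans by (meson order_trans)
qed

lemma short_orbit:
  assumes "orn \<delta>"
    and small: "\<And>l. l \<in> V \<Longrightarrow> dn l = {l} \<Longrightarrow> \<exists>v. l \<sqsubseteq> v \<and> v \<noteq> r \<and> card (dn v) + 2 * dep v \<le> Suc m"
    and "m > 0"
  shows "card (orbit V par r \<delta>) \<le> m"
proof -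
  have "\<exists>v. l \<sqsubseteq> v \<and> v \<noteq> r \<and> card (dn v) + 2 * dep v \<le> (m - 1) + 2"
    if "l \<in> V" "dn l = {l}" for l using small[OF that] assms(3) by simp
  then have "card (orbit V par r \<delta>) \<le> (m - 1) + 1"
    by (intro card_orbit_le[OF assms(1)] reaches_bottom[OF assms(1)]) auto
  then show ?thesis using assms(3) by simp
qed

subsection \<open>Maximal chains\<close>

lemma ex_leaf_below: assumes "v \<in> V" shows "\<exists>l\<in>V. dn l = {l} \<and> l \<sqsubseteq> v"
proof -
  have "v \<in> dn v" using le_refl[OF assms] by simp
  moreover have "dn v \<subseteq> V" using le_V(1)[of _ v] dn_iff by blast
  ultimately obtain l where l: "l \<in> dn v" "\<forall>y\<in>dn v. y \<sqsubseteq> l \<longrightarrow> y = l"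
    using minimal_elem[of "dn v"] by blast
  have "y = l" if "y \<sqsubseteq> l" for y using l le_trans[OF that] that by simp
  moreover have "l \<in> V" using l(1) le_V(1) by simp
  ultimately have "dn l = {l}" using le_refl by auto
  then show ?thesis using l(1) \<open>l \<in> V\<close> by auto
qed

text \<open>The minimum of a maximal chain lies above some leaf, whose path to the root contains the
  chain and so equals it. Conversely, a node comparable with a leaf lies above it.\<close>

lemma max_chains_eq: "max_chains V par r = up V par r ` {l \<in> V. dn l = {l}}"
proof (intro equalityI subsetI)
  have chain: "is_chain V par r (up V par r l)" for l
    unfolding is_chain_def using le_linear[of l] le_V(2)[of l] by auto
  {
    fix C assume C: "C \<in> max_chains V par r"
    then have c: "C \<subseteq> V" "\<And>x y. x \<in> C \<Longrightarrow> y \<in> C \<Longrightarrow> x \<sqsubseteq> y \<or> y \<sqsubseteq> x"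
      and max: "\<And>E. is_chain V par r E \<Longrightarrow> C \<subseteq> E \<Longrightarrow> E = C"
      unfolding max_chains_def is_chain_def by blast+
    have "is_chain V par r {r}" unfolding is_chain_def using root_in_V le_refl by simp
    then have "C \<noteq> {}" using max[of "{r}"] by blast
    then obtain v where v: "v \<in> C" "\<forall>y\<in>C. y \<sqsubseteq> v \<longrightarrow> y = v" using minimal_elem[OF c(1)] by blast
    obtain l where l: "l \<in> V" "dn l = {l}" "l \<sqsubseteq> v" using ex_leaf_below v(1) c(1) by blast
    have "C \<subseteq> up V par r l"
    proof
      fix y assume "y \<in> C"
      then have "v \<sqsubseteq> y" using c(2)[OF v(1)] v(2) by blast
      then show "y \<in> up V par r l" using le_trans[OF l(3)] by simp
    qed
    then have "C = up V par r l" using max[OF chain] by blast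
    then show "C \<in> up V par r ` {l \<in> V. dn l = {l}}" using l by blast
  next
    fix C assume "C \<in> up V par r ` {l \<in> V. dn l = {l}}"
    then obtain l where l: "l \<in> V" "dn l = {l}" "C = up V par r l" by blast
    have "E = C" if E: "is_chain V par r E" "C \<subseteq> E" for E
    proof -
      have "l \<in> E" using E(2) l le_refl by auto
      have "l \<sqsubseteq> y" if "y \<in> E" for y
      proof -
        have "l \<sqsubseteq> y \<or> y \<sqsubseteq> l" using E(1) \<open>l \<in> E\<close> that unfolding is_chain_def by blast
        moreover have "y = l" if "y \<sqsubseteq> l" using l(2) that dn_iff by blast
        ultimately show ?thesis using le_refl[OF l(1)] by blast
      qed
      then show ?thesis using E(2) l(3) by auto
    qed
    then show "C \<in> max_chains V par r" using chain l(3) unfolding max_chains_def by blast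
  }
qed

lemma max_orbit:
  assumes "card V \<ge> 2"
  shows "Max ((\<lambda>\<delta>. card (orbit V par r \<delta>)) ` Orn V par r) =
         Max ((\<lambda>C. Min ((\<lambda>v. card (dn v) + 2 * dep v - 1) ` (C - {r}))) ` max_chains V par r)"
    (is "Max ?A = Max ?B")
proof -
  define h where "h v = card (dn v) + 2 * dep v - 1" for v
  define F where "F l = Min (h ` (up V par r l - {r}))" for l
  let ?L = "{l \<in> V. dn l = {l}}"
  have B: "?B = F ` ?L" unfolding max_chains_eq h_def F_def by (simp add: image_image)
  have finB: "finite (F ` ?L)" using finite_V by simp
  \<comment> \<open>With two or more nodes the root is no leaf, so every \<open>Min\<close> ranges
    over a nonempty set.\<close>
  have leaf_ne: "l \<noteq> r" if "dn l = {l}" for l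
  proof
    assume "l = r"
    have "V \<subseteq> dn r" using le_root by auto
    then have "card V \<le> card (dn r)" by (rule card_mono[OF finite_dn])
    then show False using assms that \<open>l = r\<close> by simp
  qed
  have F_le: "F l \<le> h v" if "l \<sqsubseteq> v" "v \<noteq> r" for l v
    unfolding F_def using that finite_up by (intro Min_le) auto
  have F_in: "\<exists>v. l \<sqsubseteq> v \<and> v \<noteq> r \<and> h v = F l" if "l \<in> ?L" for l
  proof -
    have "l \<in> up V par r l - {r}" using that leaf_ne le_refl by auto
    then have "F l \<in> h ` (up V par r l - {r})"
      unfolding F_def using finite_up by (intro Min_in) auto
    then show ?thesis by auto
  qed
  \<comment> \<open>Off the root the depth is positive, so the subtraction in \<open>h\<close> does
    not truncate and \<open>h\<close> is positive.\<close>
  have h: "h v > 0" "card (dn v) + 2 * dep v = Suc (h v)" if "v \<in> V" "v \<noteq> r" for v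
    using card_dn_pos[OF that(1)] depth_par[OF that] unfolding h_def by simp_all
  obtain l0 where l0: "l0 \<in> ?L" using ex_leaf_below[OF root_in_V] by blast
  then have neB: "F ` ?L \<noteq> {}" by blast
  have up: "card (orbit V par r \<delta>) \<le> Max (F ` ?L)" if "orn \<delta>" for \<delta>
  proof (rule short_orbit[OF that])
    have small: "\<exists>v. l \<sqsubseteq> v \<and> v \<noteq> r \<and> v \<in> V \<and> h v \<le> Max (F ` ?L)" if "l \<in> ?L" for l
    proof -
      obtain v where v: "l \<sqsubseteq> v" "v \<noteq> r" "h v = F l" using F_in[OF \<open>l \<in> ?L\<close>] by blast
      have "F l \<le> Max (F ` ?L)" using Max_ge[OF finB] that by blast
      then show ?thesis using v le_V(2) by auto
    qed
    show "\<exists>v. l \<sqsubseteq> v \<and> v \<noteq> r \<and> card (dn v) + 2 * dep v \<le> Suc (Max (F ` ?L))"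
      if "l \<in> V" "dn l = {l}" for l
      using small[of l] that h(2) by fastforce
    show "0 < Max (F ` ?L)" using small[OF l0] h(1) by fastforce
  qed
  have low: "\<exists>\<delta>. orn \<delta> \<and> F l \<le> card (orbit V par r \<delta>)" if "l \<in> ?L" for l
  proof (rule long_orbit)
    show "l \<in> V" "dn l = {l}" "l \<noteq> r" using that leaf_ne by auto
    show "F l < card (dn v) + 2 * dep v" if "l \<sqsubseteq> v" "v \<noteq> r" for v
      using F_le[OF that] h(2)[OF le_V(2)[OF that(1)] that(2)] by simp
  qed
  have finA: "finite ?A" using finite_Orn by simp
  have neA: "?A \<noteq> {}" using low[OF l0] unfolding Orn_def by blast
  have "Max ?A \<le> Max (F ` ?L)"
    using Max.boundedI[OF finA neA] up unfolding Orn_def by blast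
  moreover have "Max (F ` ?L) \<le> Max ?A"
  proof (rule Max.boundedI[OF finB neB])
    fix a assume "a \<in> F ` ?L"
    then obtain l where l: "l \<in> ?L" "a = F l" by blast
    obtain \<delta> where "orn \<delta>" "F l \<le> card (orbit V par r \<delta>)" using low[OF l(1)] by blast
    moreover from this(1) have "card (orbit V par r \<delta>) \<le> Max ?A"
      by (intro Max_ge[OF finA]) (simp add: Orn_def)
    ultimately show "a \<le> Max ?A" using l(2) by simp
  qed
  ultimately show ?thesis unfolding B by simp
qed

end

theorem theorem1p1:
  fixes V :: "'a set" and par :: "'a \<Rightarrow> 'a" and r :: 'a
  assumes "rooted_tree V par r" and "card V \<ge> 2"
  shows "Max ((\<lambda>\<delta>. card (orbit V par r \<delta>)) ` Orn V par r) =
         Max ((\<lambda>C. Min ((\<lambda>v. card (down V par r v) + 2 * depth V par r v - 1) ` (C - {r})))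
                ` max_chains V par r)"
proof -
  interpret rtree V par r by unfold_locales (rule assms(1))
  show ?thesis by (rule max_orbit[OF assms(2)])
qed

end
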